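(* For every $\varphi\in L^\infty(\mathbb{T})$, the weighted dual truncated Toeplitz operator $D_\varphi^{\mathcal{M}}$ is complex symmetric with respect to the conjugation $J_{\mathcal{M}}|_{\mathcal{M}^\perp}$; that is, $$J_{\mathcal{M}}D_\varphi^{\mathcal{M}}J_{\mathcal{M}}=(D_\varphi^{\mathcal{M}})^*\quad\text{on }\mathcal{M}^\perp.$$
   Context: $\mathbb{D}$ is the open unit disk, $\mathbb{T}=\partial\mathbb{D}$, and $L^2(\mathbb{T})$ is taken with respect to normalized Lebesgue measure $m$, with inner product linear in the first variable. $H^2\subset L^2(\mathbb{T})$ is the Hardy space (functions with vanishing negative Fourier coefficients, also viewed as analytic functions on $\mathbb{D}$). For $f\in H^2$, $S^*f=(f-f(0))/z$. For an inner function $u$, $\mathcal{K}_u=H^2\ominus uH^2$. A closed subspace $\mathcal{M}\subset H^2$ is nearly $S^*$-invariant if $f\in\mathcal{M}$, $f(0)=0$ imply $S^*f\in\mathcal{M}$. Setting: $\mathcal{M}=h\mathcal{K}_u$ is a nonzero proper closed nearly $S^*$-invariant subspace of $H^2$, where $u$ is a nonconstant inner function with $u(0)=0$ and $h\in\mathcal{M}$ is the extremal function of $\mathcal{M}$: $\|h\|_2=1$, $h(0)>0$, $h\perp\{f\in\mathcal{M}:f(0)=0\}$, and multiplication by $h$ is an isometry from $\mathcal{K}_u$ onto $\mathcal{M}$. $\mathcal{M}^\perp=L^2(\mathbb{T})\ominus\mathcal{M}$, and $P_{\mathcal{M}^\perp}$ is the orthogonal projection of $L^2(\mathbb{T})$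 onto it. For $\varphi\in L^\infty(\mathbb{T})$, $D_\varphi^{\mathcal{M}}:\mathcal{M}^\perp\to\mathcal{M}^\perp$ is defined by $D_\varphi^{\mathcal{M}}f=P_{\mathcal{M}^\perp}(\varphi f)$. A conjugation on a Hilbert space is a conjugate-linear isometric involution. Since $h\neq0$ a.e. on $\mathbb{T}$, one may define $J_{\mathcal{M}}:L^2(\mathbb{T})\to L^2(\mathbb{T})$ by $J_{\mathcal{M}}f=u\,\bar z\,\frac{h}{\bar h}\,\bar f$ (quotient defined arbitrarily on the null set where $h=0$). $J_{\mathcal{M}}$ is a conjugation on $L^2(\mathbb{T})$ leaving $\mathcal{M}^\perp$ invariant. *)

theory Defs
  imports "HOL-Probability.Probability"
begin

section \<open>Measurable functions on the unit circle modulo almost everywhere equality\<close>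

text \<open>Normalized Lebesgue measure on the unit circle, as a Borel measure on the plane
  which is carried by the circle.\<close>

definition circle_measure :: "complex measure" where
  "circle_measure = distr (uniform_measure lborel {0..<2 * pi}) borel cis"

lemma space_circle_measure [simp]: "space circle_measure = UNIV"
  and sets_circle_measure [simp, measurable_cong]: "sets circle_measure = sets borel"
  by (simp_all add: circle_measure_def)

lemma measurable_cis [measurable]: "cis \<in> borel_measurable borel"
  by (intro borel_measurable_continuous_onI continuous_intros)

lemma measurable_cnj [measurable]: "cnj \<in> borel_measurable borel"
  by (intro borel_measurable_continuous_onI continuous_intros)

lemma prob_space_circle_measure: "prob_space circle_measure"
  unfolding circle_measure_def
  by (intro prob_space.prob_space_distr prob_space_uniform_measure) auto

definition ae_eq :: "(complex \<Rightarrow> complex) \<Rightarrow> (complex \<Rightarrow> complex) \<Rightarrow> bool" where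
  "ae_eq f g \<longleftrightarrow>
     f \<in> borel_measurable circle_measure \<and> g \<in> borel_measurable circle_measure \<and> (AE z in circle_measure. f z = g z)"

text \<open>All measurable functions are admitted, so that products and quotients are total;
  the Lebesgue and Hardy spaces are subsets of this type.\<close>

quotient_type circle_fun = "complex \<Rightarrow> complex" / partial: ae_eq
proof (rule part_equivpI)
  show "\<exists>f. ae_eq f f"
    by (rule exI[of _ "\<lambda>_. 0"]) (simp add: ae_eq_def)
  show "symp ae_eq"
    by (rule sympI) (auto simp: ae_eq_def)
  show "transp ae_eq"
    by (rule transpI) (auto simp: ae_eq_def)
qed

instantiation circle_fun :: "{comm_ring_1, inverse}"
begin

lift_definition zero_circle_fun :: circle_fun is "\<lambda>_. 0"
  by (simp add: ae_eq_def)

lift_definition one_circle_fun :: circle_fun is "\<lambda>_. 1"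
  by (simp add: ae_eq_def)

lift_definition plus_circle_fun :: "circle_fun \<Rightarrow> circle_fun \<Rightarrow> circle_fun"
  is "\<lambda>f g z. f z + g z"
  by (auto simp: ae_eq_def)

lift_definition minus_circle_fun :: "circle_fun \<Rightarrow> circle_fun \<Rightarrow> circle_fun"
  is "\<lambda>f g z. f z - g z"
  by (auto simp: ae_eq_def)

lift_definition uminus_circle_fun :: "circle_fun \<Rightarrow> circle_fun"
  is "\<lambda>f z. - f z"
  by (auto simp: ae_eq_def)

lift_definition times_circle_fun :: "circle_fun \<Rightarrow> circle_fun \<Rightarrow> circle_fun"
  is "\<lambda>f g z. f z * g z"
  by (auto simp: ae_eq_def)

lift_definition inverse_circle_fun :: "circle_fun \<Rightarrow> circle_fun"
  is "\<lambda>f z. inverse (f z)"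
  by (auto simp: ae_eq_def)

lift_definition divide_circle_fun :: "circle_fun \<Rightarrow> circle_fun \<Rightarrow> circle_fun"
  is "\<lambda>f g z. f z / g z"
  by (auto simp: ae_eq_def)

instance
proof
  show "(0 :: circle_fun) \<noteq> 1"
  proof (transfer, rule notI)
    assume "ae_eq (\<lambda>_. 0) (\<lambda>_. 1)"
    then have "AE z in circle_measure. False"
      by (simp add: ae_eq_def)
    moreover have "prob_space circle_measure"
      by (rule prob_space_circle_measure)
    ultimately show False
      by (simp add: prob_space.AE_False)
  qed
qed (transfer; auto simp: ae_eq_def algebra_simps)+

end

lift_definition const :: "complex \<Rightarrow> circle_fun" is "\<lambda>c _. c"
  by (simp add: ae_eq_def)

lift_definition zvar :: circle_fun is "\<lambda>z. z"
  by (simp add: ae_eq_def)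

lift_definition cnj_fun :: "circle_fun \<Rightarrow> circle_fun" is "\<lambda>f z. cnj (f z)"
  by (auto simp: ae_eq_def intro!: measurable_compose[OF _ measurable_cnj])

interpretation circle_fun: vector_space "\<lambda>c f. const c * f"
  by standard (transfer; auto simp: ae_eq_def algebra_simps)+


section \<open>Lebesgue spaces\<close>

lift_definition square_integrable :: "circle_fun \<Rightarrow> bool"
  is "\<lambda>f. integrable circle_measure (\<lambda>z. (cmod (f z))\<^sup>2)"
  by (rule integrable_cong_AE) (auto simp: ae_eq_def)

definition L2 :: "circle_fun set" where
  "L2 = {f. square_integrable f}"

lift_definition l2_inner :: "circle_fun \<Rightarrow> circle_fun \<Rightarrow> complex"
  is "\<lambda>f g. \<integral>z. f z * cnj (g z) \<partial>circle_measure"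
  by (rule integral_cong_AE)
     (auto simp: ae_eq_def intro!: borel_measurable_times measurable_compose[OF _ measurable_cnj])

lift_definition l2_norm :: "circle_fun \<Rightarrow> real"
  is "\<lambda>f. sqrt (\<integral>z. (cmod (f z))\<^sup>2 \<partial>circle_measure)"
  by (intro arg_cong[where f = sqrt] integral_cong_AE) (auto simp: ae_eq_def)

lift_definition essentially_bounded :: "circle_fun \<Rightarrow> bool"
  is "\<lambda>f. \<exists>C. AE z in circle_measure. cmod (f z) \<le> C"
proof -
  have *: "\<exists>C. AE z in circle_measure. cmod (g z) \<le> C"
    if "ae_eq f g" and "\<exists>C. AE z in circle_measure. cmod (f z) \<le> C" for f g
  proof -
    from that(2) obtain C where "AE z in circle_measure. cmod (f z) \<le> C" ..
    moreover from that(1) have "AE z in circle_measure. f z = g z"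
      by (simp add: ae_eq_def)
    ultimately have "AE z in circle_measure. cmod (g z) \<le> C"
      by eventually_elim simp
    then show ?thesis ..
  qed
  fix f g assume "ae_eq f g"
  moreover from this have "ae_eq g f"
    by (auto simp: ae_eq_def)
  ultimately show "(\<exists>C. AE z in circle_measure. cmod (f z) \<le> C) \<longleftrightarrow>
      (\<exists>C. AE z in circle_measure. cmod (g z) \<le> C)"
    using * by blast
qed

definition Linf :: "circle_fun set" where
  "Linf = {f. essentially_bounded f}"

definition closed_subspace :: "circle_fun set \<Rightarrow> bool" where
  "closed_subspace N \<longleftrightarrow> N \<subseteq> L2 \<and> circle_fun.subspace N \<and>
     (\<forall>X f. (\<forall>n. X n \<in> N) \<and> f \<in> L2 \<and> (\<lambda>n. l2_norm (X n - f)) \<longlonglongrightarrow> 0 \<longrightarrow> f \<in> N)"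

definition orth :: "circle_fun set \<Rightarrow> circle_fun set" where
  "orth N = {f \<in> L2. \<forall>g\<in>N. l2_inner f g = 0}"

text \<open>Projections and adjoints are given by their defining properties; the descriptions are
  proper when \<open>N\<close> is a closed subspace and \<open>A\<close> is bounded and linear on it.\<close>

definition proj :: "circle_fun set \<Rightarrow> circle_fun \<Rightarrow> circle_fun" where
  "proj N f = (THE g. g \<in> N \<and> (\<forall>k\<in>N. l2_inner (f - g) k = 0))"

definition adjoint_on ::
  "circle_fun set \<Rightarrow> (circle_fun \<Rightarrow> circle_fun) \<Rightarrow> circle_fun \<Rightarrow> circle_fun" where
  "adjoint_on N A g = (THE g'. g' \<in> N \<and> (\<forall>f\<in>N. l2_inner (A f) g = l2_inner f g'))"

definition conjugation_on :: "circle_fun set \<Rightarrow> (circle_fun \<Rightarrow> circle_fun) \<Rightarrow> bool" where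
  "conjugation_on N C \<longleftrightarrow>
     (\<forall>f\<in>N. C f \<in> N) \<and>
     (\<forall>f\<in>N. \<forall>g\<in>N. C (f + g) = C f + C g) \<and>
     (\<forall>c. \<forall>f\<in>N. C (const c * f) = const (cnj c) * C f) \<and>
     (\<forall>f\<in>N. l2_norm (C f) = l2_norm f) \<and>
     (\<forall>f\<in>N. C (C f) = f)"

definition complex_symmetric_on ::
  "circle_fun set \<Rightarrow> (circle_fun \<Rightarrow> circle_fun) \<Rightarrow> (circle_fun \<Rightarrow> circle_fun) \<Rightarrow> bool" where
  "complex_symmetric_on N C A \<longleftrightarrow>
     conjugation_on N C \<and> (\<forall>f\<in>N. C (A (C f)) = adjoint_on N A f)"


section \<open>Hardy space, model spaces and nearly invariant subspaces\<close>

lift_definition fourier :: "circle_fun \<Rightarrow> int \<Rightarrow> complex"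
  is "\<lambda>f n. \<integral>z. f z * z powi (- n) \<partial>circle_measure"
proof (rule ext, rule integral_cong_AE)
  have [measurable]: "(\<lambda>z::complex. z powi k) \<in> borel_measurable borel" for k
    unfolding power_int_def by measurable
  fix f g :: "complex \<Rightarrow> complex" and n :: int
  assume "ae_eq f g"
  then have [measurable]: "f \<in> borel_measurable borel" "g \<in> borel_measurable borel"
    and eq: "AE z in circle_measure. f z = g z"
    by (auto simp: ae_eq_def cong: measurable_cong_sets)
  show "(\<lambda>z. f z * z powi (- n)) \<in> borel_measurable circle_measure"
    and "(\<lambda>z. g z * z powi (- n)) \<in> borel_measurable circle_measure"
    by measurable
  show "AE z in circle_measure. f z * z powi (- n) = g z * z powi (- n)"
    using eq by eventually_elim simp
qed

definition H2 :: "circle_fun set" where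
  "H2 = {f \<in> L2. \<forall>n<0. fourier f n = 0}"

text \<open>The value at a point \<open>w\<close> of the open unit disk of the analytic function with
  boundary function \<open>f \<in> H2\<close>.\<close>

definition disk_value :: "circle_fun \<Rightarrow> complex \<Rightarrow> complex" where
  "disk_value f w = (\<Sum>n. fourier f (int n) * w ^ n)"

definition backward_shift :: "circle_fun \<Rightarrow> circle_fun" where
  "backward_shift f = (f - const (disk_value f 0)) / zvar"

text \<open>Inner functions are identified with their boundary functions.\<close>

definition inner_function :: "circle_fun \<Rightarrow> bool" where
  "inner_function u \<longleftrightarrow> u \<in> H2 \<and> u * cnj_fun u = 1"

definition model_space :: "circle_fun \<Rightarrow> circle_fun set" where
  "model_space u = H2 \<inter> orth ((\<lambda>f. u * f) ` H2)"

definition nearly_invariant :: "circle_fun set \<Rightarrow> bool" where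
  "nearly_invariant M \<longleftrightarrow> closed_subspace M \<and> M \<subseteq> H2 \<and>
     (\<forall>f\<in>M. disk_value f 0 = 0 \<longrightarrow> backward_shift f \<in> M)"

definition extremal_function :: "circle_fun set \<Rightarrow> circle_fun \<Rightarrow> bool" where
  "extremal_function M h \<longleftrightarrow> h \<in> M \<and> l2_norm h = 1 \<and>
     disk_value h 0 \<in> \<real> \<and> Re (disk_value h 0) > 0 \<and>
     h \<in> orth {f \<in> M. disk_value f 0 = 0}"

definition dual_toeplitz :: "circle_fun set \<Rightarrow> circle_fun \<Rightarrow> circle_fun \<Rightarrow> circle_fun" where
  "dual_toeplitz M \<phi> f = proj (orth M) (\<phi> * f)"

definition J_conj :: "circle_fun \<Rightarrow> circle_fun \<Rightarrow> circle_fun \<Rightarrow> circle_fun" where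
  "J_conj u h f = u * cnj_fun zvar * (h / cnj_fun h) * cnj_fun f"

end

theory Submission
  imports Defs
begin

text \<open>
  The conjugation has the form \<open>J f = q * cnj f\<close> with \<open>q = u / z * (h / cnj h)\<close>. As soon as \<open>q\<close> is
  unimodular, \<open>J\<close> is a conjugation of the whole \<open>L\<^sup>2\<close> space with \<open>\<langle>J f, g\<rangle> = \<langle>J g, f\<rangle>\<close>, and
  \<open>J\<close> turns multiplication by \<open>\<phi>\<close> into multiplication by \<open>cnj \<phi>\<close>: \<open>J (\<phi> * J f) = cnj \<phi> * f\<close>.
  If moreover \<open>J\<close> maps a closed subspace \<open>N\<close> into itself, it commutes with the projection onto \<open>N\<close>,
  so it turns the compression of \<open>\<phi>\<close> to \<open>N\<close> into the compression of \<open>cnj \<phi>\<close>, which is the adjoint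
  (\<open>complex_symmetric_compression\<close>). Two points remain for \<open>N = orth M\<close>.

  Invariance. By the symmetry of \<open>J\<close> it is enough that \<open>J\<close> maps \<open>M\<close> into itself. Since
  \<open>J (h * k) = h * (u / z * cnj k)\<close>, this is the invariance of the model space under
  \<open>k \<mapsto> u / z * cnj k\<close> (\<open>model_space_conj\<close>), which rests on the fact that the product of two Hardy space
  functions has no Fourier coefficients of negative index (\<open>mean_zvar_mult_H2\<close>).

  Unimodularity. One needs \<open>h \<noteq> 0\<close> almost everywhere, an instance of the F. and M. Riesz
  uniqueness theorem; here \<open>h(0) > 0\<close>. The proof (\<open>H2_quotient_self\<close>) follows Helson and
  Lowdenslager: let \<open>g\<close> be the component of \<open>h\<close> orthogonal to the closed span \<open>S\<close> of
  \<open>z h, z\<^sup>2 h, \<dots>\<close>. Then \<open>g \<noteq> 0\<close>, because the functions in \<open>S\<close> have mean zero and \<open>h\<close> has not; and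
  \<open>z\<^sup>n g \<in> S\<close> for \<open>n \<ge> 1\<close>, so that \<open>|g|\<^sup>2\<close> has no nonzero Fourier coefficients except
  the mean and is a positive constant. But \<open>g\<close> vanishes wherever \<open>h\<close> does.

  Both points use the projection theorem (\<open>orthogonal_decomposition\<close>), obtained from the completeness of
  \<open>L\<^sup>2\<close>, and the uniqueness theorem for Fourier coefficients of integrable functions
  (\<open>Fourier_uniqueness\<close>), obtained from the Stone--Weierstrass theorem. Closed spans appear
  as double orthogonal complements throughout, which replaces approximation arguments by
  algebra with inner products.
\<close>

section \<open>Integration of circle functions\<close>

interpretation circle: prob_space circle_measure
  by (rule prob_space_circle_measure)

text \<open>Inner products, norms and Fourier coefficients are all means of products in the ring of
  circle functions. With the mean and its domain as functions on the quotient type, the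
  arguments below are computations in that ring.\<close>

lift_definition L1_fun :: "circle_fun \<Rightarrow> bool" is "\<lambda>f. integrable circle_measure f"
  by (rule integrable_cong_AE) (auto simp: ae_eq_def)

lift_definition mean :: "circle_fun \<Rightarrow> complex" is "\<lambda>f. \<integral>z. f z \<partial>circle_measure"
  by (rule integral_cong_AE) (auto simp: ae_eq_def)

lemma AE_circle_norm: "AE z in circle_measure. cmod z = 1"
  unfolding circle_measure_def
  by (subst AE_distr_iff) auto

lemma L1_fun_add: "L1_fun f \<Longrightarrow> L1_fun g \<Longrightarrow> L1_fun (f + g)"
  by transfer auto

lemma L1_fun_diff: "L1_fun f \<Longrightarrow> L1_fun g \<Longrightarrow> L1_fun (f - g)"
  by transfer auto

lemma L1_fun_const [simp]: "L1_fun (const c)"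
  by transfer auto

lemma mean_add: "L1_fun f \<Longrightarrow> L1_fun g \<Longrightarrow> mean (f + g) = mean f + mean g"
  by transfer auto

lemma mean_diff: "L1_fun f \<Longrightarrow> L1_fun g \<Longrightarrow> mean (f - g) = mean f - mean g"
  by transfer auto

lemma mean_const_mult: "mean (const c * f) = c * mean f"
  by transfer auto

lemma mean_const [simp]: "mean (const c) = c"
  by transfer (simp add: circle.prob_space[simplified])

lemma const_0: "const 0 = 0" and const_1: "const 1 = 1"
  by (transfer, simp add: ae_eq_def)+

lemma mean_0 [simp]: "mean 0 = 0"
  using mean_const[of 0] by (simp only: const_0)

lemma mean_cnj: "mean (cnj_fun f) = cnj (mean f)"
  by transfer (rule Bochner_Integration.integral_cnj)

lemma L2_iff_L1: "f \<in> L2 \<longleftrightarrow> L1_fun (f * cnj_fun f)"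
  unfolding L2_def mem_Collect_eq
proof transfer
  fix f assume "ae_eq f f"
  have "integrable circle_measure (\<lambda>z. f z * cnj (f z)) \<longleftrightarrow>
     integrable circle_measure (\<lambda>z. complex_of_real ((cmod (f z))\<^sup>2))"
    by (simp only: complex_norm_square)
  then show "integrable circle_measure (\<lambda>z. (cmod (f z))\<^sup>2) =
     integrable circle_measure (\<lambda>z. f z * cnj (f z))"
    by (simp only: complex_of_real_integrable_eq)
qed

lemma l2_inner_eq: "l2_inner f g = mean (f * cnj_fun g)"
  by transfer simp

lemma l2_norm_inner: "l2_inner f f = of_real ((l2_norm f)\<^sup>2)"
proof transfer
  fix f assume "ae_eq f f"
  have "(\<integral>z. f z * cnj (f z) \<partial>circle_measure) = (\<integral>z. of_real ((cmod (f z))\<^sup>2) \<partial>circle_measure)"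
    by (simp only: complex_norm_square)
  then show "(\<integral>z. f z * cnj (f z) \<partial>circle_measure) =
     of_real ((sqrt (\<integral>z. (cmod (f z))\<^sup>2 \<partial>circle_measure))\<^sup>2)"
    by (simp add: integral_complex_of_real del: of_real_power)
qed

lemma l2_norm_nonneg [simp]: "0 \<le> l2_norm f"
  by transfer simp

text \<open>The bound \<open>2 |fg| \<le> |f|\<^sup>2 + |g|\<^sup>2\<close> makes inner products of square integrable functions
  proper integrals.\<close>

lemma L1_fun_mult:
  assumes "f \<in> L2" "g \<in> L2"
  shows "L1_fun (f * g)"
  using assms unfolding L2_def mem_Collect_eq
proof transfer
  fix f g :: "complex \<Rightarrow> complex"
  assume *: "ae_eq f f" "ae_eq g g" "integrable circle_measure (\<lambda>z. (cmod (f z))\<^sup>2)"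
    "integrable circle_measure (\<lambda>z. (cmod (g z))\<^sup>2)"
  show "integrable circle_measure (\<lambda>z. f z * g z)"
  proof (rule Bochner_Integration.integrable_bound)
    show "integrable circle_measure (\<lambda>z. (cmod (f z))\<^sup>2 + (cmod (g z))\<^sup>2)"
      using * by auto
    show "(\<lambda>z. f z * g z) \<in> borel_measurable circle_measure"
      using * by (auto simp: ae_eq_def)
    have "cmod (f z * g z) \<le> norm ((cmod (f z))\<^sup>2 + (cmod (g z))\<^sup>2)" for z
    proof -
      have "2 * (cmod (f z) * cmod (g z)) \<le> (cmod (f z))\<^sup>2 + (cmod (g z))\<^sup>2"
        using sum_squares_bound[of "cmod (f z)" "cmod (g z)"] by simp
      moreover have "0 \<le> cmod (f z) * cmod (g z)" by simp
      ultimately have "cmod (f z) * cmod (g z) \<le> (cmod (f z))\<^sup>2 + (cmod (g z))\<^sup>2" by linarith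
      then show ?thesis by (simp add: norm_mult)
    qed
    then show "AE z in circle_measure. cmod (f z * g z) \<le> norm ((cmod (f z))\<^sup>2 + (cmod (g z))\<^sup>2)"
      by simp
  qed
qed

lemma cnj_fun_simps [simp]:
  "cnj_fun (f + g) = cnj_fun f + cnj_fun g" "cnj_fun (f - g) = cnj_fun f - cnj_fun g"
  "cnj_fun (f * g) = cnj_fun f * cnj_fun g" "cnj_fun (f / g) = cnj_fun f / cnj_fun g"
  "cnj_fun (cnj_fun f) = f" "cnj_fun (const c) = const (cnj c)"
  "cnj_fun 1 = 1" "cnj_fun 0 = 0"
  by (transfer, auto simp: ae_eq_def)+

lemma cnj_fun_power [simp]: "cnj_fun (f ^ n) = cnj_fun f ^ n"
  by (induction n) auto

lemma const_simps: "const (a + b) = const a + const b" "const (a * b) = const a * const b"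
  by (transfer, simp add: ae_eq_def)+

lemma L2_cnj: "f \<in> L2 \<Longrightarrow> cnj_fun f \<in> L2"
  by (simp add: L2_iff_L1 mult.commute)

lemma const_in_Linf: "const c \<in> Linf"
  unfolding Linf_def mem_Collect_eq by transfer auto

lemma Linf_cnj: "f \<in> Linf \<Longrightarrow> cnj_fun f \<in> Linf"
  unfolding Linf_def mem_Collect_eq by transfer auto

lemma Linf_mult:
  assumes "f \<in> Linf" "g \<in> Linf"
  shows "f * g \<in> Linf"
  using assms unfolding Linf_def mem_Collect_eq
proof (transfer, clarify)
  fix f g :: "complex \<Rightarrow> complex" and C D
  assume "AE z in circle_measure. cmod (f z) \<le> C" "AE z in circle_measure. cmod (g z) \<le> D"
  then have "AE z in circle_measure. cmod (f z * g z) \<le> C * D"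
    by eventually_elim (auto simp: norm_mult intro!: mult_mono intro: order_trans[OF norm_ge_zero])
  then show "\<exists>C. AE z in circle_measure. cmod (f z * g z) \<le> C" ..
qed

lemma unimodular_in_Linf:
  assumes "f * cnj_fun f = 1"
  shows "f \<in> Linf"
  using assms unfolding Linf_def mem_Collect_eq
proof transfer
  fix f assume "ae_eq (\<lambda>z. f z * cnj (f z)) (\<lambda>_. 1)"
  then have "AE z in circle_measure. f z * cnj (f z) = 1" by (simp add: ae_eq_def)
  then have "AE z in circle_measure. cmod (f z) \<le> 1"
  proof eventually_elim
    case (elim z)
    then have "(cmod (f z))\<^sup>2 = 1" by (metis complex_norm_square of_real_eq_1_iff)
    then show ?case by (simp add: abs_square_eq_1)
  qed
  then show "\<exists>C. AE z in circle_measure. cmod (f z) \<le> C" ..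
qed

lemma L1_fun_Linf_mult:
  assumes "f \<in> Linf" "L1_fun g"
  shows "L1_fun (f * g)"
  using assms unfolding Linf_def mem_Collect_eq
proof (transfer, clarify)
  fix f g :: "complex \<Rightarrow> complex" and C
  assume *: "ae_eq f f" "ae_eq g g" "integrable circle_measure g"
    and C: "AE z in circle_measure. cmod (f z) \<le> C"
  show "integrable circle_measure (\<lambda>z. f z * g z)"
  proof (rule Bochner_Integration.integrable_bound)
    show "integrable circle_measure (\<lambda>z. C * norm (g z))"
      using * by auto
    show "(\<lambda>z. f z * g z) \<in> borel_measurable circle_measure"
      using * by (auto simp: ae_eq_def)
    show "AE z in circle_measure. cmod (f z * g z) \<le> norm (C * cmod (g z))"
      using C
    proof eventually_elim
      case (elim z)
      then show ?case
        by (auto simp: norm_mult abs_mult intro!: mult_mono)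
    qed
  qed
qed

lemma Linf_mult_L2:
  assumes "f \<in> Linf" "g \<in> L2"
  shows "f * g \<in> L2"
proof -
  have "L1_fun ((f * cnj_fun f) * (g * cnj_fun g))"
    using assms by (simp add: L1_fun_Linf_mult Linf_mult Linf_cnj L2_iff_L1)
  then show ?thesis by (simp add: L2_iff_L1 mult_ac)
qed

lemma L2_add: "f \<in> L2 \<Longrightarrow> g \<in> L2 \<Longrightarrow> f + g \<in> L2"
  by (simp add: L2_iff_L1[of "f + g"] ring_distribs L1_fun_add L1_fun_mult L2_cnj)

lemma L2_diff: "f \<in> L2 \<Longrightarrow> g \<in> L2 \<Longrightarrow> f - g \<in> L2"
  by (simp add: L2_iff_L1[of "f - g"] ring_distribs L1_fun_diff L1_fun_mult L2_cnj)

lemma L2_scale: "f \<in> L2 \<Longrightarrow> const c * f \<in> L2"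
  by (rule Linf_mult_L2[OF const_in_Linf])

lemma L2_const [simp]: "const c \<in> L2"
  by (simp add: L2_iff_L1 flip: const_simps)

lemma L2_0 [simp]: "0 \<in> L2" and L2_1 [simp]: "1 \<in> L2"
  using L2_const[of 0] L2_const[of 1] by (simp_all only: const_0 const_1)


section \<open>The geometry of the Hilbert space\<close>

lemma inner_add_left: "f \<in> L2 \<Longrightarrow> g \<in> L2 \<Longrightarrow> k \<in> L2 \<Longrightarrow> l2_inner (f + g) k = l2_inner f k + l2_inner g k"
  by (simp add: l2_inner_eq ring_distribs mean_add L1_fun_mult L2_cnj)

lemma inner_diff_left: "f \<in> L2 \<Longrightarrow> g \<in> L2 \<Longrightarrow> k \<in> L2 \<Longrightarrow> l2_inner (f - g) k = l2_inner f k - l2_inner g k"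
  by (simp add: l2_inner_eq ring_distribs mean_diff L1_fun_mult L2_cnj)

lemma inner_commute: "l2_inner g f = cnj (l2_inner f g)"
  by (simp add: l2_inner_eq flip: mean_cnj) (simp add: mult.commute)

lemma inner_add_right: "f \<in> L2 \<Longrightarrow> g \<in> L2 \<Longrightarrow> k \<in> L2 \<Longrightarrow> l2_inner k (f + g) = l2_inner k f + l2_inner k g"
  by (simp add: l2_inner_eq ring_distribs mean_add L1_fun_mult L2_cnj)

lemma inner_diff_right: "f \<in> L2 \<Longrightarrow> g \<in> L2 \<Longrightarrow> k \<in> L2 \<Longrightarrow> l2_inner k (f - g) = l2_inner k f - l2_inner k g"
  by (simp add: l2_inner_eq ring_distribs mean_diff L1_fun_mult L2_cnj)

lemma inner_scale_left: "l2_inner (const c * f) g = c * l2_inner f g"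
  by (simp add: l2_inner_eq mult.assoc mean_const_mult)

lemma inner_scale_right: "l2_inner f (const c * g) = cnj c * l2_inner f g"
  by (simp add: l2_inner_eq mult.left_commute[of _ "const _"] mean_const_mult)

lemma inner_mult_left: "l2_inner (a * f) g = l2_inner f (cnj_fun a * g)"
  by (simp add: l2_inner_eq mult_ac)

lemma inner_0 [simp]: "l2_inner 0 f = 0" "l2_inner f 0 = 0"
  by (simp_all add: l2_inner_eq)

lemma l2_norm_eq_0:
  assumes "f \<in> L2" "l2_norm f = 0"
  shows "f = 0"
  using assms unfolding L2_def mem_Collect_eq
proof transfer
  fix f assume *: "ae_eq f f" "integrable circle_measure (\<lambda>z. (cmod (f z))\<^sup>2)"
    "sqrt (\<integral>z. (cmod (f z))\<^sup>2 \<partial>circle_measure) = 0"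
  then have "AE z in circle_measure. (cmod (f z))\<^sup>2 = 0"
    by (subst (asm) real_sqrt_eq_0_iff, subst (asm) integral_nonneg_eq_0_iff_AE) auto
  then show "ae_eq f (\<lambda>_. 0)"
    using * by (simp add: ae_eq_def)
qed

lemma inner_self_eq_0: "f \<in> L2 \<Longrightarrow> l2_inner f f = 0 \<Longrightarrow> f = 0"
  using l2_norm_eq_0[of f] by (simp add: l2_norm_inner)

lemma l2_norm_0 [simp]: "l2_norm 0 = 0"
  using l2_norm_inner[of 0] by simp

lemma l2_norm_sq_add:
  assumes "f \<in> L2" "g \<in> L2"
  shows "(l2_norm (f + g))\<^sup>2 = (l2_norm f)\<^sup>2 + 2 * Re (l2_inner f g) + (l2_norm g)\<^sup>2"
proof -
  have "of_real ((l2_norm (f + g))\<^sup>2) = l2_inner f f + l2_inner f g + cnj (l2_inner f g) + l2_inner g g"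
    unfolding l2_norm_inner[symmetric] inner_commute[of g f, symmetric]
    using assms by (simp add: inner_add_left inner_add_right L2_add)
  from arg_cong[OF this, of Re] show ?thesis
    by (simp add: l2_norm_inner del: of_real_power)
qed

lemma l2_norm_sq_diff:
  assumes "f \<in> L2" "g \<in> L2"
  shows "(l2_norm (f - g))\<^sup>2 = (l2_norm f)\<^sup>2 - 2 * Re (l2_inner f g) + (l2_norm g)\<^sup>2"
proof -
  have "of_real ((l2_norm (f - g))\<^sup>2) = l2_inner f f - l2_inner f g - cnj (l2_inner f g) + l2_inner g g"
    unfolding l2_norm_inner[symmetric] inner_commute[of g f, symmetric]
    using assms by (simp add: inner_diff_left inner_diff_right L2_diff)
  from arg_cong[OF this, of Re] show ?thesis
    by (simp add: l2_norm_inner del: of_real_power)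
qed

lemma l2_norm_scale: "l2_norm (const c * f) = cmod c * l2_norm f"
proof -
  have "complex_of_real ((l2_norm (const c * f))\<^sup>2) = of_real ((cmod c * l2_norm f)\<^sup>2)"
    using complex_norm_square[of c]
    by (simp add: l2_norm_inner[symmetric] inner_scale_left inner_scale_right power_mult_distrib
          del: of_real_power)
  then have "(l2_norm (const c * f))\<^sup>2 = (cmod c * l2_norm f)\<^sup>2"
    by (simp only: of_real_eq_iff)
  then show ?thesis
    by (simp add: power2_eq_iff_nonneg)
qed

text \<open>Minimizing the quadratic function \<open>t \<mapsto> \<parallel>f - t k\<parallel>\<^sup>2\<close>. With the lower bound \<open>d = 0\<close> this is the
  Cauchy--Schwarz inequality; with \<open>d = \<parallel>f\<parallel>\<^sup>2\<close>, when \<open>f\<close> itself is the minimizer, it gives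
  \<open>f \<bottom> k\<close>, which is how nearest points become orthogonal projections.\<close>

lemma inner_bound_of_minimal:
  assumes f: "f \<in> L2" and k: "k \<in> L2"
    and min: "\<And>t. d \<le> (l2_norm (f - const t * k))\<^sup>2"
  shows "(cmod (l2_inner f k))\<^sup>2 \<le> ((l2_norm f)\<^sup>2 - d) * (l2_norm k)\<^sup>2"
proof (cases "k = 0")
  case True
  then show ?thesis by simp
next
  case False
  define b where "b = (l2_norm k)\<^sup>2"
  define a where "a = l2_inner f k"
  have b: "b > 0"
    using False l2_norm_eq_0[OF k] by (auto simp: b_def)
  \<comment> \<open>the minimizer of the quadratic function\<close>
  define t where "t = a / of_real b"
  have "Re (l2_inner f (const t * k)) = (cmod a)\<^sup>2 / b"
  proof -
    have "l2_inner f (const t * k) = (a * cnj a) / of_real b"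
      by (simp add: inner_scale_right t_def a_def)
    also have "\<dots> = of_real ((cmod a)\<^sup>2 / b)"
      by (simp only: complex_norm_square of_real_divide)
    finally show ?thesis by simp
  qed
  moreover have "(l2_norm (const t * k))\<^sup>2 = (cmod a)\<^sup>2 / b"
    using b by (simp add: l2_norm_scale t_def norm_divide power_mult_distrib power_divide
          power2_eq_square[of b] flip: b_def)
  ultimately have "d \<le> (l2_norm f)\<^sup>2 - (cmod a)\<^sup>2 / b"
    using min[of t] f k by (simp add: l2_norm_sq_diff L2_scale)
  then show ?thesis
    using b by (simp add: a_def[symmetric] b_def[symmetric] field_simps)
qed

lemma Cauchy_Schwarz:
  assumes "f \<in> L2" "g \<in> L2"
  shows "cmod (l2_inner f g) \<le> l2_norm f * l2_norm g"
proof -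
  have "(cmod (l2_inner f g))\<^sup>2 \<le> (l2_norm f * l2_norm g)\<^sup>2"
    using inner_bound_of_minimal[OF assms, of 0] by (simp add: power_mult_distrib)
  then show ?thesis by (rule power2_le_imp_le) simp
qed

lemma l2_norm_triangle:
  assumes "f \<in> L2" "g \<in> L2"
  shows "l2_norm (f + g) \<le> l2_norm f + l2_norm g"
proof (rule power2_le_imp_le)
  have "Re (l2_inner f g) \<le> l2_norm f * l2_norm g"
    using Cauchy_Schwarz[OF assms] complex_Re_le_cmod order_trans by blast
  then show "(l2_norm (f + g))\<^sup>2 \<le> (l2_norm f + l2_norm g)\<^sup>2"
    using assms by (simp add: l2_norm_sq_add power2_sum)
qed simp

lemma parallelogram:
  assumes "f \<in> L2" "g \<in> L2"
  shows "(l2_norm (f + g))\<^sup>2 + (l2_norm (f - g))\<^sup>2 = 2 * (l2_norm f)\<^sup>2 + 2 * (l2_norm g)\<^sup>2"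
  using assms by (simp add: l2_norm_sq_add l2_norm_sq_diff)


section \<open>Completeness and orthogonal projections\<close>

lemma circle_fun_rep:
  obtains F where "f = abs_circle_fun F" "F \<in> borel_measurable circle_measure" "ae_eq F F"
proof -
  have "ae_eq (rep_circle_fun f) (rep_circle_fun f)"
    using Quotient_rep_reflp[OF Quotient_circle_fun] .
  moreover have "abs_circle_fun (rep_circle_fun f) = f"
    using Quotient_abs_rep[OF Quotient_circle_fun] .
  ultimately show ?thesis
    using that[of "rep_circle_fun f"] by (auto simp: ae_eq_def)
qed

text \<open>On a probability space the variance of \<open>|f|\<close> is nonnegative, so the \<open>L\<^sup>1\<close> norm is at most the \<open>L\<^sup>2\<close> norm.\<close>

lemma nn_integral_norm_le_l2:
  assumes [measurable]: "f \<in> borel_measurable circle_measure"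
    and sq: "integrable circle_measure (\<lambda>z. (cmod (f z))\<^sup>2)"
  shows "(\<integral>\<^sup>+z. ennreal (cmod (f z)) \<partial>circle_measure) \<le>
    ennreal (sqrt (\<integral>z. (cmod (f z))\<^sup>2 \<partial>circle_measure))"
proof -
  have int: "integrable circle_measure (\<lambda>z. cmod (f z))"
    by (rule circle.square_integrable_imp_integrable[OF _ sq]) auto
  have "0 \<le> (\<integral>z. (cmod (f z))\<^sup>2 \<partial>circle_measure) - (\<integral>z. cmod (f z) \<partial>circle_measure)\<^sup>2"
    using circle.variance_positive[of "\<lambda>z. cmod (f z)"] circle.variance_eq[OF int sq] by simp
  then have "(\<integral>z. cmod (f z) \<partial>circle_measure) \<le> sqrt (\<integral>z. (cmod (f z))\<^sup>2 \<partial>circle_measure)"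
    by (intro real_le_rsqrt) simp
  then show ?thesis
    by (subst nn_integral_eq_integral[OF int]) (auto intro: ennreal_leI)
qed

text \<open>A rapidly Cauchy sequence has absolutely summable increments almost everywhere, because
  their \<open>L\<^sup>1\<close> norms are dominated by their \<open>L\<^sup>2\<close> norms; Fatou's lemma turns the pointwise limit
  into a limit in norm.\<close>

lemma Riesz_Fischer:
  assumes X: "\<And>n. X n \<in> L2" and fast: "\<And>n. l2_norm (X (Suc n) - X n) \<le> (1/2)^n"
  obtains f where "f \<in> L2" "(\<lambda>n. l2_norm (X n - f)) \<longlonglongrightarrow> 0"
proof -
  have "\<exists>F. \<forall>n. X n = abs_circle_fun (F n) \<and> F n \<in> borel_measurable circle_measure \<and> ae_eq (F n) (F n)"
    by (intro choice) (metis circle_fun_rep)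
  then obtain F where F: "\<And>n. X n = abs_circle_fun (F n)" "\<And>n. ae_eq (F n) (F n)"
    and [measurable]: "\<And>n. F n \<in> borel_measurable circle_measure" by blast
  define G where "G z = lim (\<lambda>n. F n z)" for z
  have diff: "X m - X n = abs_circle_fun (\<lambda>z. F m z - F n z)" for m n
    by (simp add: F minus_circle_fun.abs_eq)
  have ae_diff: "ae_eq (\<lambda>z. F m z - F n z) (\<lambda>z. F m z - F n z)" for m n
    by (simp add: ae_eq_def)
  have int_diff: "integrable circle_measure (\<lambda>z. (cmod (F m z - F n z))\<^sup>2)" for m n
    using L2_diff[OF X[of m] X[of n]] ae_diff[of m n]
    by (simp add: diff L2_def square_integrable.abs_eq)
  have norm_diff: "l2_norm (X m - X n) = sqrt (\<integral>z. (cmod (F m z - F n z))\<^sup>2 \<partial>circle_measure)" for m n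
    using ae_diff[of m n] by (simp add: diff l2_norm.abs_eq)
  have tail: "l2_norm (X (n + k) - X n) \<le> 2 * (1/2)^n" for n k
  proof -
    have "l2_norm (X (n + k) - X n) \<le> 2 * (1/2)^n - 2 * (1/2)^(n+k)"
    proof (induction k)
      case (Suc k)
      have "l2_norm ((X (Suc (n + k)) - X (n + k)) + (X (n + k) - X n))
          \<le> l2_norm (X (Suc (n + k)) - X (n + k)) + l2_norm (X (n + k) - X n)"
        by (intro l2_norm_triangle L2_diff X)
      also have "\<dots> \<le> (1/2)^(n+k) + (2 * (1/2)^n - 2 * (1/2)^(n+k))"
        using Suc.IH fast[of "n+k"] by simp
      finally show ?case by simp
    qed simp
    also have "\<dots> \<le> 2 * (1/2)^n" by simp
    finally show ?thesis .
  qed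
  have "(\<integral>\<^sup>+z. (\<Sum>n. ennreal (cmod (F (Suc n) z - F n z))) \<partial>circle_measure) =
      (\<Sum>n. \<integral>\<^sup>+z. ennreal (cmod (F (Suc n) z - F n z)) \<partial>circle_measure)"
    by (rule nn_integral_suminf) measurable
  also have "\<dots> \<le> (\<Sum>n. ennreal ((1/2)^n))"
  proof (rule suminf_le)
    fix n
    have "(\<integral>\<^sup>+z. ennreal (cmod (F (Suc n) z - F n z)) \<partial>circle_measure)
        \<le> ennreal (l2_norm (X (Suc n) - X n))"
      unfolding norm_diff by (rule nn_integral_norm_le_l2) (auto intro: int_diff)
    also have "\<dots> \<le> ennreal ((1/2)^n)"
      using fast by (rule ennreal_leI)
    finally show "(\<integral>\<^sup>+z. ennreal (cmod (F (Suc n) z - F n z)) \<partial>circle_measure) \<le> ennreal ((1/2)^n)" .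
  qed auto
  also have "\<dots> = ennreal (\<Sum>n. (1/2)^n)"
    by (rule suminf_ennreal2) (auto intro: summable_geometric)
  also have "\<dots> < \<infinity>" by simp
  finally have "AE z in circle_measure. (\<Sum>n. ennreal (cmod (F (Suc n) z - F n z))) \<noteq> \<infinity>"
    by (intro nn_integral_PInf_AE) auto
  then have "AE z in circle_measure. convergent (\<lambda>n. F n z)"
  proof eventually_elim
    case (elim z)
    then have "summable (\<lambda>n. cmod (F (Suc n) z - F n z))"
      by (intro summable_suminf_not_top) auto
    then have "summable (\<lambda>n. F (Suc n) z - F n z)"
      by (rule summable_norm_cancel)
    then have "convergent (\<lambda>n. F 0 z + (\<Sum>i<n. F (Suc i) z - F i z))"
      by (intro convergent_add) (auto simp: convergent_const summable_iff_convergent)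
    moreover have "F 0 z + (\<Sum>i<n. F (Suc i) z - F i z) = F n z" for n
      by (subst sum_lessThan_telescope) simp
    ultimately show ?case by simp
  qed
  then have lim: "AE z in circle_measure. (\<lambda>n. F n z) \<longlonglongrightarrow> G z"
    by eventually_elim (simp add: convergent_LIMSEQ_iff G_def)
  have [measurable]: "G \<in> borel_measurable circle_measure"
    unfolding G_def by (rule borel_measurable_lim_metric) measurable
  have fatou: "(\<integral>\<^sup>+z. ennreal ((cmod (F n z - G z))\<^sup>2) \<partial>circle_measure) \<le> ennreal ((2 * (1/2)^n)\<^sup>2)" for n
  proof -
    have "(\<integral>\<^sup>+z. ennreal ((cmod (F n z - G z))\<^sup>2) \<partial>circle_measure) =
      (\<integral>\<^sup>+z. liminf (\<lambda>k. ennreal ((cmod (F (n + k) z - F n z))\<^sup>2)) \<partial>circle_measure)"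
    proof (rule nn_integral_cong_AE, use lim in eventually_elim)
      case (elim z)
      then have "(\<lambda>k. F (n + k) z) \<longlonglongrightarrow> G z"
        using LIMSEQ_ignore_initial_segment[of _ _ n] by (simp add: add.commute)
      then have "(\<lambda>k. ennreal ((cmod (F (n + k) z - F n z))\<^sup>2)) \<longlonglongrightarrow> ennreal ((cmod (G z - F n z))\<^sup>2)"
        by (intro tendsto_ennrealI tendsto_intros)
      from lim_imp_Liminf[OF _ this] show ?case
        by (simp add: norm_minus_commute)
    qed
    also have "\<dots> \<le> liminf (\<lambda>k. \<integral>\<^sup>+z. ennreal ((cmod (F (n + k) z - F n z))\<^sup>2) \<partial>circle_measure)"
      by (rule nn_integral_liminf) measurable
    also have "\<dots> \<le> liminf (\<lambda>k. ennreal ((2 * (1/2)^n)\<^sup>2))"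
    proof (rule Liminf_mono, rule always_eventually, rule allI)
      fix k
      have "(\<integral>\<^sup>+z. ennreal ((cmod (F (n + k) z - F n z))\<^sup>2) \<partial>circle_measure) = ennreal ((l2_norm (X (n + k) - X n))\<^sup>2)"
        by (subst nn_integral_eq_integral[OF int_diff]) (auto simp: norm_diff)
      also have "\<dots> \<le> ennreal ((2 * (1/2)^n)\<^sup>2)"
        by (intro ennreal_leI power_mono tail) simp
      finally show "(\<integral>\<^sup>+z. ennreal ((cmod (F (n + k) z - F n z))\<^sup>2) \<partial>circle_measure) \<le> ennreal ((2 * (1/2)^n)\<^sup>2)" .
    qed
    also have "\<dots> = ennreal ((2 * (1/2)^n)\<^sup>2)"
      by (rule Liminf_const) simp
    finally show ?thesis .
  qed
  have int: "integrable circle_measure (\<lambda>z. (cmod (F n z - G z))\<^sup>2)" for n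
    using fatou[of n] by (intro integrableI_bounded) (auto simp: le_less_trans)
  define f where "f = abs_circle_fun G"
  have ae: "ae_eq (\<lambda>z. F n z - G z) (\<lambda>z. F n z - G z)" "ae_eq G G" for n
    by (simp_all add: ae_eq_def)
  have diff_f: "X n - f = abs_circle_fun (\<lambda>z. F n z - G z)" for n
    by (simp add: F f_def minus_circle_fun.abs_eq ae)
  have "l2_norm (X n - f) \<le> 2 * (1/2)^n" for n
  proof -
    have "ennreal (\<integral>z. (cmod (F n z - G z))\<^sup>2 \<partial>circle_measure) \<le> ennreal ((2 * (1/2)^n)\<^sup>2)"
      using fatou[of n] by (subst (asm) nn_integral_eq_integral[OF int]) auto
    then have "(\<integral>z. (cmod (F n z - G z))\<^sup>2 \<partial>circle_measure) \<le> (2 * (1/2)^n)\<^sup>2"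
      by (subst (asm) ennreal_le_iff) auto
    then have "sqrt (\<integral>z. (cmod (F n z - G z))\<^sup>2 \<partial>circle_measure) \<le> 2 * (1/2)^n"
      by (intro real_le_lsqrt) auto
    then show ?thesis
      using ae by (simp add: diff_f l2_norm.abs_eq)
  qed
  moreover have "(\<lambda>n. 2 * (1/2)^n) \<longlonglongrightarrow> (0::real)"
    by (intro tendsto_mult_right_zero LIMSEQ_power_zero) simp
  ultimately have "(\<lambda>n. l2_norm (X n - f)) \<longlonglongrightarrow> 0"
    using Lim_null_comparison[of "\<lambda>n. l2_norm (X n - f)" "\<lambda>n. 2 * (1/2)^n" sequentially]
    by (auto intro: always_eventually)
  moreover have "f \<in> L2"
  proof -
    have "X 0 - f \<in> L2"
      using int[of 0] ae by (simp add: diff_f L2_def square_integrable.abs_eq)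
    from L2_diff[OF X[of 0] this] show ?thesis by simp
  qed
  ultimately show thesis by (rule that[rotated])
qed

lemma closed_subspace_L2: "closed_subspace N \<Longrightarrow> f \<in> N \<Longrightarrow> f \<in> L2"
  by (auto simp: closed_subspace_def)

lemma closed_subspace_add: "closed_subspace N \<Longrightarrow> f \<in> N \<Longrightarrow> g \<in> N \<Longrightarrow> f + g \<in> N"
  by (auto simp: closed_subspace_def circle_fun.subspace_def)

lemma closed_subspace_scale: "closed_subspace N \<Longrightarrow> f \<in> N \<Longrightarrow> const c * f \<in> N"
  by (auto simp: closed_subspace_def circle_fun.subspace_def)

lemma closed_subspace_diff: "closed_subspace N \<Longrightarrow> f \<in> N \<Longrightarrow> g \<in> N \<Longrightarrow> f - g \<in> N"
  by (auto simp: closed_subspace_def intro: circle_fun.subspace_diff)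

text \<open>A sequence in \<open>N\<close> whose distances to \<open>f\<close> tend to the infimum is Cauchy by the parallelogram
  law; its limit is a nearest point, and the difference to a nearest point is orthogonal to \<open>N\<close>.\<close>

theorem orthogonal_decomposition:
  assumes N: "closed_subspace N" and f: "f \<in> L2"
  obtains m where "m \<in> N" "f - m \<in> orth N"
proof -
  define S where "S = (\<lambda>m. (l2_norm (f - m))\<^sup>2) ` N"
  define d where "d = Inf S"
  have "0 \<in> N"
    using N by (auto simp: closed_subspace_def circle_fun.subspace_def)
  then have S: "S \<noteq> {}" "bdd_below S"
    by (auto simp: S_def intro!: bdd_belowI[of _ 0])
  have d_le: "d \<le> (l2_norm (f - m))\<^sup>2" if "m \<in> N" for m
    unfolding d_def using S(2) that by (intro cInf_lower) (auto simp: S_def)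
  \<comment> \<open>the rate is chosen such that the parallelogram law yields increments of norm at most \<open>(1/2)^n\<close>\<close>
  have "\<exists>m\<in>N. (l2_norm (f - m))\<^sup>2 < d + (1/4)^n / 4" for n :: nat
    using cInf_lessD[OF S(1), of "d + (1/4)^n / 4"] by (auto simp: S_def d_def)
  then obtain m where m: "\<And>n. m n \<in> N" "\<And>n. (l2_norm (f - m n))\<^sup>2 < d + (1/4)^n / 4"
    by metis
  note mL2 [simp] = closed_subspace_L2[OF N m(1)]
  have "l2_norm (m (Suc n) - m n) \<le> (1/2)^n" for n
  proof -
    let ?a = "f - m n" and ?b = "f - m (Suc n)"
    let ?c = "const (1/2) * (m n + m (Suc n))"
    have "?a + ?b = const 2 * (f - ?c)"
    proof -
      have "const 2 * ?c = m n + m (Suc n)"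
        by (simp add: const_1 flip: mult.assoc const_simps)
      moreover have "const 2 * f = f + f"
        using const_simps(1)[of 1 1] by (simp add: const_1 ring_distribs)
      ultimately show ?thesis by (simp add: right_diff_distrib)
    qed
    then have "(l2_norm (?a + ?b))\<^sup>2 = 4 * (l2_norm (f - ?c))\<^sup>2"
      by (simp add: l2_norm_scale power_mult_distrib)
    moreover have "d \<le> (l2_norm (f - ?c))\<^sup>2"
      by (intro d_le closed_subspace_scale[OF N] closed_subspace_add[OF N] m)
    moreover have "(l2_norm (?a + ?b))\<^sup>2 + (l2_norm (?a - ?b))\<^sup>2 = 2 * (l2_norm ?a)\<^sup>2 + 2 * (l2_norm ?b)\<^sup>2"
      using f by (intro parallelogram L2_diff) auto
    moreover have "(1/4::real)^Suc n \<le> (1/4)^n" by simp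
    ultimately have "(l2_norm (?a - ?b))\<^sup>2 \<le> (1/4)^n"
      using m(2)[of n] m(2)[of "Suc n"] by linarith
    also have "(1/4::real)^n = ((1/2)^n)\<^sup>2"
      by (simp add: power2_eq_square flip: power_mult_distrib)
    finally show ?thesis
      by (auto intro: power2_le_imp_le)
  qed
  with mL2 obtain m' where m': "m' \<in> L2" "(\<lambda>n. l2_norm (m n - m')) \<longlonglongrightarrow> 0"
    by (rule Riesz_Fischer)
  then have "m' \<in> N"
    using N m(1) by (auto simp: closed_subspace_def)
  have le: "(l2_norm (f - m'))\<^sup>2 \<le> d"
  proof -
    have "l2_norm (f - m') \<le> sqrt (d + (1/4)^n / 4) + l2_norm (m n - m')" for n
    proof -
      have "l2_norm ((f - m n) + (m n - m')) \<le> l2_norm (f - m n) + l2_norm (m n - m')"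
        using f m' by (intro l2_norm_triangle L2_diff) auto
      moreover have "l2_norm (f - m n) \<le> sqrt (d + (1/4)^n / 4)"
        using m(2)[of n] by (intro real_le_rsqrt) simp
      ultimately show ?thesis by simp
    qed
    moreover have "(\<lambda>n. sqrt (d + (1/4)^n / 4) + l2_norm (m n - m')) \<longlonglongrightarrow> sqrt (d + 0 / 4) + 0"
      using m' by (intro tendsto_intros LIMSEQ_power_zero) auto
    ultimately have "l2_norm (f - m') \<le> sqrt d"
      by (intro LIMSEQ_le_const) auto
    moreover have "0 \<le> d"
      unfolding d_def using S(1) by (rule cInf_greatest) (auto simp: S_def)
    ultimately show ?thesis
      by (metis l2_norm_nonneg power_mono real_sqrt_pow2)
  qed
  have "l2_inner (f - m') k = 0" if k: "k \<in> N" for k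
  proof -
    have "(cmod (l2_inner (f - m') k))\<^sup>2 \<le> ((l2_norm (f - m'))\<^sup>2 - d) * (l2_norm k)\<^sup>2"
    proof (rule inner_bound_of_minimal)
      fix t
      have "d \<le> (l2_norm (f - (m' + const t * k)))\<^sup>2"
        by (intro d_le closed_subspace_add[OF N] closed_subspace_scale[OF N] k \<open>m' \<in> N\<close>)
      then show "d \<le> (l2_norm (f - m' - const t * k))\<^sup>2"
        by (simp add: algebra_simps)
    qed (use f m' closed_subspace_L2[OF N k] in \<open>auto intro: L2_diff\<close>)
    also have "\<dots> \<le> 0"
      using le by (simp add: mult_le_0_iff)
    finally show ?thesis by simp
  qed
  then show thesis
    using that[of m'] \<open>m' \<in> N\<close> f m' by (auto simp: orth_def L2_diff)
qed

lemma closed_subspace_orth: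
  assumes "A \<subseteq> L2"
  shows "closed_subspace (orth A)"
  unfolding closed_subspace_def
proof (intro conjI allI impI)
  show "orth A \<subseteq> L2" by (auto simp: orth_def)
  show "circle_fun.subspace (orth A)"
    using assms unfolding circle_fun.subspace_def orth_def
    by (auto simp: L2_add L2_scale inner_scale_left inner_add_left subset_eq)
  fix X f
  assume X: "(\<forall>n. X n \<in> orth A) \<and> f \<in> L2 \<and> (\<lambda>n. l2_norm (X n - f)) \<longlonglongrightarrow> 0"
  have "l2_inner f g = 0" if g: "g \<in> A" for g
  proof -
    have "cmod (l2_inner f g) \<le> l2_norm (X n - f) * l2_norm g" for n
    proof -
      have *: "X n \<in> L2" "l2_inner (X n) g = 0" "g \<in> L2" "f \<in> L2"
        using X g assms by (auto simp: orth_def)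
      then have "l2_inner f g = - l2_inner (X n - f) g"
        by (simp add: inner_diff_left)
      then show ?thesis
        using * Cauchy_Schwarz[of "X n - f" g] by (simp add: L2_diff)
    qed
    moreover have "(\<lambda>n. l2_norm (X n - f) * l2_norm g) \<longlonglongrightarrow> 0"
      using X by (intro tendsto_mult_left_zero) auto
    ultimately have "cmod (l2_inner f g) \<le> 0"
      by (intro LIMSEQ_le_const) auto
    then show ?thesis by simp
  qed
  then show "f \<in> orth A"
    using X by (auto simp: orth_def)
qed

lemma subset_orth_orth: "A \<subseteq> L2 \<Longrightarrow> A \<subseteq> orth (orth A)"
  by (auto simp: orth_def) (metis complex_cnj_zero inner_commute)

lemma orth_Int: "closed_subspace N \<Longrightarrow> f \<in> N \<Longrightarrow> f \<in> orth N \<Longrightarrow> f = 0"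
  by (auto simp: orth_def intro!: inner_self_eq_0)


section \<open>Uniqueness of Fourier coefficients\<close>

text \<open>All mixed moments \<open>z\<^sup>m * cnj z\<^sup>n\<close> are required to vanish, although on the circle they reduce to
  powers of \<open>z\<close> and of \<open>cnj z\<close>: in this form the condition visibly survives multiplication
  by \<open>z\<close> and by \<open>cnj z\<close>, hence by real polynomials in the coordinates.\<close>

definition vanishing_moments :: "(complex \<Rightarrow> complex) \<Rightarrow> bool" where
  "vanishing_moments W \<longleftrightarrow> integrable circle_measure W \<and>
     (\<forall>m n. (\<integral>z. W z * (z ^ m * cnj z ^ n) \<partial>circle_measure) = 0)"

lemma integrable_mult_bounded_on_circle:
  assumes W: "integrable circle_measure W" and g: "g \<in> borel_measurable borel"
    and b: "\<And>z. cmod z = 1 \<Longrightarrow> cmod (g z) \<le> b"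
  shows "integrable circle_measure (\<lambda>z. W z * g z)"
proof (rule Bochner_Integration.integrable_bound)
  show "integrable circle_measure (\<lambda>z. b * cmod (W z))"
    using W by auto
  have "g \<in> borel_measurable circle_measure" using g by (simp cong: measurable_cong_sets)
  then show "(\<lambda>z. W z * g z) \<in> borel_measurable circle_measure"
    using W by auto
  show "AE z in circle_measure. cmod (W z * g z) \<le> norm (b * cmod (W z))"
    using AE_circle_norm
  proof eventually_elim
    case (elim z)
    from b[OF elim] have "cmod (g z) \<le> \<bar>b\<bar>" by linarith
    then show ?case by (simp add: norm_mult abs_mult mult.commute[of "\<bar>b\<bar>"] mult_left_mono)
  qed
qed

lemma integrable_moment:
  assumes "integrable circle_measure W"
  shows "integrable circle_measure (\<lambda>z. W z * (z ^ m * cnj z ^ n))"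
  by (rule integrable_mult_bounded_on_circle[OF assms, of _ 1]) (auto simp: norm_mult norm_power)

lemma vanishing_moments_add:
  assumes "vanishing_moments V" "vanishing_moments W"
  shows "vanishing_moments (\<lambda>z. V z + W z)"
  using assms by (simp add: vanishing_moments_def distrib_right integrable_moment)

lemma vanishing_moments_scale:
  assumes "vanishing_moments W"
  shows "vanishing_moments (\<lambda>z. W z * c)"
  using assms by (simp add: vanishing_moments_def mult.commute[of _ c] mult.assoc)

lemma vanishing_moments_id:
  assumes "vanishing_moments W"
  shows "vanishing_moments (\<lambda>z. W z * z)"
  unfolding vanishing_moments_def
proof (intro conjI allI)
  show "integrable circle_measure (\<lambda>z. W z * z)"
    using integrable_moment[of W 1 0] assms by (simp add: vanishing_moments_def)
  fix m n
  have "W z * z * (z ^ m * cnj z ^ n) = W z * (z ^ Suc m * cnj z ^ n)" for z by simp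
  then show "(\<integral>z. W z * z * (z ^ m * cnj z ^ n) \<partial>circle_measure) = 0"
    using assms by (simp only: vanishing_moments_def)
qed

lemma vanishing_moments_cnj:
  assumes "vanishing_moments W"
  shows "vanishing_moments (\<lambda>z. W z * cnj z)"
  unfolding vanishing_moments_def
proof (intro conjI allI)
  show "integrable circle_measure (\<lambda>z. W z * cnj z)"
    using integrable_moment[of W 0 1] assms by (simp add: vanishing_moments_def)
  fix m n
  have "W z * cnj z * (z ^ m * cnj z ^ n) = W z * (z ^ m * cnj z ^ Suc n)" for z by simp
  then show "(\<integral>z. W z * cnj z * (z ^ m * cnj z ^ n) \<partial>circle_measure) = 0"
    using assms by (simp only: vanishing_moments_def)
qed

text \<open>The statement is quantified over \<open>W\<close>, so that a product of polynomials is handled by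
  multiplying with one factor after the other; linear functions are combinations of \<open>z\<close> and \<open>cnj z\<close>.\<close>

lemma vanishing_moments_real_polynomial:
  assumes "real_polynomial_function p" "vanishing_moments W"
  shows "vanishing_moments (\<lambda>z. W z * of_real (p z))"
  using assms
proof (induction p arbitrary: W)
  case (linear f)
  interpret bounded_linear f by fact
  have "W z * of_real (f z) = W z * z * ((of_real (f 1) - \<i> * of_real (f \<i>)) / 2)
      + W z * cnj z * ((of_real (f 1) + \<i> * of_real (f \<i>)) / 2)" for z
  proof -
    have "f z = f (Re z *\<^sub>R 1 + Im z *\<^sub>R \<i>)"
      by (rule arg_cong[where f = f]) (simp add: complex_eq_iff)
    also have "\<dots> = Re z * f 1 + Im z * f \<i>"
      by (simp only: add scale real_scaleR_def)
    finally have f: "f z = Re z * f 1 + Im z * f \<i>" .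
    show ?thesis
      unfolding f by (cases z) (simp add: complex_eq_iff field_simps)
  qed
  then show ?case
    by (simp only:) (intro vanishing_moments_add vanishing_moments_scale
      vanishing_moments_id vanishing_moments_cnj linear.prems)
next
  case (add f g)
  then show ?case
    using vanishing_moments_add[of "\<lambda>z. W z * of_real (f z)" "\<lambda>z. W z * of_real (g z)"]
    by (simp add: distrib_left)
next
  case (mult f g)
  then have "vanishing_moments (\<lambda>z. W z * of_real (f z) * of_real (g z))" by blast
  then show ?case by (simp add: mult.assoc)
qed (rule vanishing_moments_scale)

text \<open>Continuous functions are uniformly approximated on the circle by real polynomials, and \<open>W\<close> is integrable.\<close>

lemma vanishing_moments_integral_continuous:
  assumes W: "vanishing_moments W" and f: "continuous_on UNIV f"
  shows "(\<integral>z. W z * of_real (f z) \<partial>circle_measure) = 0"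
proof -
  define I where "I = (\<integral>z. cmod (W z) \<partial>circle_measure)"
  have WI: "integrable circle_measure W"
    using W by (simp add: vanishing_moments_def)
  have "I \<ge> 0" by (simp add: I_def)
  have [measurable]: "f \<in> borel_measurable borel"
    using f by (rule borel_measurable_continuous_onI)
  have cS: "compact (sphere (0::complex) 1)" by simp
  have fS: "continuous_on (sphere 0 1) f"
    using f continuous_on_subset by blast
  from compact_imp_bounded[OF compact_continuous_image[OF fS cS]]
  obtain B where "\<forall>x\<in>f ` sphere 0 1. norm x \<le> B"
    by (auto simp: bounded_iff)
  then have B: "\<bar>f z\<bar> \<le> B" if "cmod z = 1" for z
    using that by auto
  have *: "cmod (\<integral>z. W z * of_real (f z) \<partial>circle_measure) \<le> I * e" if "e > 0" for e
  proof -
    obtain p where p: "real_polynomial_function p" "\<And>z. z \<in> sphere 0 1 \<Longrightarrow> \<bar>f z - p z\<bar> < e"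
      by (rule Stone_Weierstrass_real_polynomial_function[OF cS fS \<open>e > 0\<close>], rule that, auto)
    note Wp = vanishing_moments_real_polynomial[OF p(1) W]
    have eq: "(\<integral>z. W z * of_real (f z) \<partial>circle_measure) =
      (\<integral>z. W z * of_real (f z) - W z * of_real (p z) \<partial>circle_measure)"
    proof (subst Bochner_Integration.integral_diff)
      show "integrable circle_measure (\<lambda>z. W z * of_real (f z))"
        by (rule integrable_mult_bounded_on_circle[OF WI, of _ B]) (auto intro: B)
      show "integrable circle_measure (\<lambda>z. W z * of_real (p z))"
        using Wp by (simp add: vanishing_moments_def)
      have "(\<integral>z. W z * of_real (p z) \<partial>circle_measure) = 0"
        using Wp unfolding vanishing_moments_def by (auto dest!: spec[of _ 0])
      then show "(\<integral>z. W z * of_real (f z) \<partial>circle_measure) =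
          (\<integral>z. W z * of_real (f z) \<partial>circle_measure) - (\<integral>z. W z * of_real (p z) \<partial>circle_measure)"
        by simp
    qed
    also have "cmod \<dots> \<le> (\<integral>z. cmod (W z) * e \<partial>circle_measure)"
    proof (rule order_trans[OF Bochner_Integration.integral_norm_bound], rule integral_mono_AE')
      show "integrable circle_measure (\<lambda>z. cmod (W z) * e)" using WI by auto
      show "AE z in circle_measure. cmod (W z * of_real (f z) - W z * of_real (p z)) \<le> cmod (W z) * e"
        using AE_circle_norm
      proof eventually_elim
        case (elim z)
        have "cmod (W z * of_real (f z) - W z * of_real (p z)) = cmod (W z) * \<bar>f z - p z\<bar>"
          by (simp add: norm_mult flip: right_diff_distrib of_real_diff)
        then show ?case
          using p(2)[of z] elim by (auto intro!: mult_left_mono)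
      qed
      show "AE z in circle_measure. 0 \<le> cmod (W z) * e"
        using \<open>e > 0\<close> by simp
    qed
    finally show ?thesis by (simp add: I_def)
  qed
  have "cmod (\<integral>z. W z * of_real (f z) \<partial>circle_measure) \<le> 0"
  proof (rule field_le_epsilon)
    fix e :: real assume "e > 0"
    have "I * (e / (I + 1)) \<le> e"
      using \<open>I \<ge> 0\<close> \<open>e > 0\<close> by (simp add: field_simps)
    then show "cmod (\<integral>z. W z * of_real (f z) \<partial>circle_measure) \<le> 0 + e"
      using *[of "e / (I + 1)"] \<open>I \<ge> 0\<close> \<open>e > 0\<close> by auto
  qed
  then show ?thesis by simp
qed

text \<open>The indicator of a closed set is the pointwise limit of the continuous functions
  \<open>max 0 (1 - n * infdist z A)\<close>.\<close>

lemma vanishing_moments_integral_closed: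
  assumes W: "vanishing_moments W" and A: "closed A"
  shows "(\<integral>z. W z * indicator A z \<partial>circle_measure) = 0"
proof (cases "A = {}")
  case False
  have [measurable]: "W \<in> borel_measurable circle_measure" and WI: "integrable circle_measure W"
    using W by (auto simp: vanishing_moments_def)
  define f where "f n z = max 0 (1 - real n * infdist z A)" for n z
  have f: "continuous_on UNIV (f n)" for n
    unfolding f_def by (intro continuous_intros)
  have [measurable]: "f n \<in> borel_measurable borel" for n
    using f by (rule borel_measurable_continuous_onI)
  have "A \<in> sets borel" using A by (rule borel_closed)
  then have [measurable]: "A \<in> sets circle_measure" by simp
  have "(\<lambda>n. \<integral>z. W z * of_real (f n z) \<partial>circle_measure) \<longlonglongrightarrow> (\<integral>z. W z * indicator A z \<partial>circle_measure)"
  proof (rule integral_dominated_convergence)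
    show "integrable circle_measure (\<lambda>z. cmod (W z))" using WI by simp
    show "AE z in circle_measure. (\<lambda>n. W z * of_real (f n z)) \<longlonglongrightarrow> W z * indicator A z"
    proof (rule AE_I2)
      fix z
      have "(\<lambda>n. complex_of_real (f n z)) \<longlonglongrightarrow> indicator A z"
      proof (cases "z \<in> A")
        case True
        then show ?thesis by (simp add: f_def)
      next
        case False
        then have pos: "infdist z A > 0"
          using A \<open>A \<noteq> {}\<close> by (simp add: infdist_pos_not_in_closed)
        obtain k where k: "1 / infdist z A < real k" using reals_Archimedean2 by blast
        have "f n z = 0" if "n \<ge> k" for n
        proof -
          have "1 / infdist z A < real n" using k that by linarith
          then show ?thesis using pos by (simp add: f_def field_simps)
        qed
        then have "eventually (\<lambda>n. complex_of_real (f n z) = 0) sequentially"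
          by (auto simp: eventually_sequentially)
        then show ?thesis using False by (simp add: tendsto_eventually)
      qed
      then show "(\<lambda>n. W z * of_real (f n z)) \<longlonglongrightarrow> W z * indicator A z"
        by (intro tendsto_intros)
    qed
    show "AE z in circle_measure. norm (W z * of_real (f n z)) \<le> cmod (W z)" for n
    proof (rule AE_I2)
      fix z
      have "\<bar>f n z\<bar> \<le> 1" by (simp add: f_def infdist_nonneg)
      then show "norm (W z * of_real (f n z)) \<le> cmod (W z)"
        by (simp add: norm_mult mult_left_le)
    qed
  qed measurable
  then have "(\<lambda>n. 0) \<longlonglongrightarrow> (\<integral>z. W z * indicator A z \<partial>circle_measure)"
    by (simp add: vanishing_moments_integral_continuous[OF W f])
  then show ?thesis
    using LIMSEQ_unique tendsto_const by blast
qed simp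

lemma sets_circle_measure_closed: "sets circle_measure = sigma_sets UNIV (Collect closed)"
  unfolding sets_circle_measure borel_eq_closed by (rule sets_measure_of) simp

text \<open>Closed sets form an intersection stable generator of the Borel sets, so the integral of \<open>W\<close>
  over every Borel set is zero.\<close>

lemma vanishing_moments_imp_AE_zero:
  assumes W: "vanishing_moments W"
  shows "AE z in circle_measure. W z = 0"
proof (rule circle.density_zero)
  show WI: "integrable circle_measure W"
    using W by (simp add: vanishing_moments_def)
  have [measurable]: "W \<in> borel_measurable circle_measure" using WI by auto
  fix A assume "A \<in> sets circle_measure"
  then have "Int_stable (Collect closed)" "Collect closed \<subseteq> Pow (UNIV :: complex set)"
    "A \<in> sigma_sets UNIV (Collect closed)"
    by (auto simp: Int_stable_def sets_circle_measure_closed simp del: sets_circle_measure)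
  then have "(\<integral>z. indicator A z *\<^sub>R W z \<partial>circle_measure) = 0"
  proof (induction rule: sigma_sets_induct_disjoint)
    case (basic A)
    then show ?case
      using vanishing_moments_integral_closed[OF W, of A]
      by (simp add: scaleR_conv_of_real mult.commute of_real_indicator)
  next
    case (compl A)
    then have [measurable]: "A \<in> sets circle_measure"
      by (simp only: sets_circle_measure_closed)
    have "(\<integral>z. indicator (UNIV - A) z *\<^sub>R W z \<partial>circle_measure) =
      (\<integral>z. W z - indicator A z *\<^sub>R W z \<partial>circle_measure)"
      by (rule Bochner_Integration.integral_cong) (auto simp: indicator_def)
    also have "\<dots> = (\<integral>z. W z \<partial>circle_measure) - (\<integral>z. indicator A z *\<^sub>R W z \<partial>circle_measure)"
      by (intro Bochner_Integration.integral_diff WI integrable_mult_indicator) fact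
    also have "(\<integral>z. W z \<partial>circle_measure) = 0"
      using W unfolding vanishing_moments_def by (auto dest!: spec[of _ 0])
    finally show ?case using compl by simp
  next
    case (union A)
    then have A [measurable]: "A i \<in> sets circle_measure" for i
      unfolding sets_circle_measure_closed by blast
    have "(\<integral>z. indicator (\<Union>i. A i) z *\<^sub>R W z \<partial>circle_measure) =
        (\<Sum>i. \<integral>z. indicator (A i) z *\<^sub>R W z \<partial>circle_measure)"
      unfolding set_lebesgue_integral_def[symmetric]
    proof (rule lebesgue_integral_countable_add[OF A])
      show "A i \<inter> A j = {}" if "i \<noteq> j" for i j
        using union(1) that by (auto simp: disjoint_family_on_def)
      show "set_integrable circle_measure (\<Union>i. A i) W"
        unfolding set_integrable_def by (intro integrable_mult_indicator WI) measurable
    qed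
    then show ?case using union by simp
  qed simp
  then show "set_lebesgue_integral circle_measure A W = 0"
    by (simp add: set_lebesgue_integral_def)
qed


section \<open>Fourier coefficients as means\<close>

text \<open>Powers in the ring of circle functions are iterated products and do not transfer to
  functions directly; this lifted version of \<open>zvar ^ n\<close> does.\<close>

lift_definition zpow :: "nat \<Rightarrow> circle_fun" is "\<lambda>n z. z ^ n"
  by (simp add: ae_eq_def)

lemma zpow_eq: "zpow n = zvar ^ n"
proof (induction n)
  case 0
  show ?case by simp (transfer, simp add: ae_eq_def)
next
  case (Suc n)
  have "zpow (Suc n) = zvar * zpow n" by transfer (simp add: ae_eq_def)
  then show ?case using Suc by simp
qed

lemma zvar_cnj: "zvar * cnj_fun zvar = 1"
proof transfer
  have "AE z in circle_measure. z * cnj z = 1"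
    using AE_circle_norm by eventually_elim (metis complex_norm_square of_real_1 power_one)
  then show "ae_eq (\<lambda>z. z * cnj z) (\<lambda>_. 1)" by (simp add: ae_eq_def)
qed

lemma zvar_power_cnj: "zvar ^ n * cnj_fun zvar ^ n = 1"
  by (simp add: zvar_cnj flip: power_mult_distrib)

lemma zvar_power_Linf: "zvar ^ n \<in> Linf" "cnj_fun zvar ^ n \<in> Linf"
  by (rule unimodular_in_Linf, simp add: zvar_power_cnj mult.commute)+

lemma zvar_power_L2: "zvar ^ n \<in> L2" "cnj_fun zvar ^ n \<in> L2"
  using Linf_mult_L2[OF zvar_power_Linf(1) L2_1] Linf_mult_L2[OF zvar_power_Linf(2) L2_1] by auto

lemma fourier_nonpos: "fourier f (- int n) = mean (f * zvar ^ n)"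
  unfolding zpow_eq[symmetric] by transfer simp

lemma H2_iff: "f \<in> H2 \<longleftrightarrow> f \<in> L2 \<and> (\<forall>n. mean (f * zvar ^ Suc n) = 0)"
proof -
  have "(\<forall>k<0. fourier f k = 0) \<longleftrightarrow> (\<forall>n. fourier f (- int (Suc n)) = 0)"
    by (auto simp del: of_nat_Suc) (metis negD)
  then show ?thesis
    by (simp only: H2_def mem_Collect_eq fourier_nonpos)
qed

lemma disk_value_0: "disk_value f 0 = mean f"
proof -
  have "disk_value f 0 = fourier f (int 0)"
    unfolding disk_value_def by (rule powser_zero)
  then show ?thesis using fourier_nonpos[of f 0] by simp
qed

text \<open>The only explicit integral that is needed: \<open>exp (i k t)\<close> has the primitive
  \<open>exp (i k t) / (i k)\<close>, which is periodic.\<close>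

lemma mean_zvar_power: "mean (zvar ^ Suc n) = 0"
proof -
  have "mean (zpow (Suc n)) = 0"
  proof transfer
    fix n :: nat
    define k where "k = Suc n"
    have k: "k > 0" by (simp add: k_def)
    let ?F = "\<lambda>t. cis (real k * t) / (\<i> * of_nat k)"
    have deriv: "(?F has_vector_derivative cis (real k * t)) (at t within {0..2 * pi})" for t
    proof -
      have "((\<lambda>w. exp (\<i> * of_nat k * w) / (\<i> * of_nat k)) has_field_derivative
          exp (\<i> * of_nat k * of_real t)) (at (of_real t))"
        using k by (auto intro!: derivative_eq_intros)
      from has_vector_derivative_real_field[OF this] show ?thesis
        by (simp add: cis_conv_exp mult_ac)
    qed
    have "(\<integral>z. z ^ k \<partial>circle_measure) =
      (\<integral>t. cis t ^ k \<partial>density lborel (\<lambda>t. ennreal (indicator {0..<2*pi} t / (2 * pi))))"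
    proof -
      have "uniform_measure lborel {0..<2*pi} =
          density lborel (\<lambda>t. ennreal (indicator {0..<2*pi} t / (2 * pi)))"
        unfolding uniform_measure_def
        by (rule arg_cong[where f = "density lborel"])
           (auto simp: fun_eq_iff indicator_def divide_ennreal simp flip: ennreal_1)
      then show ?thesis
        unfolding circle_measure_def by (subst integral_distr) auto
    qed
    also have "\<dots> = (\<integral>t. (indicator {0..<2*pi} t / (2*pi)) *\<^sub>R cis t ^ k \<partial>lborel)"
      by (rule integral_density) auto
    also have "\<dots> = (\<integral>t. (1 / (2*pi)) *\<^sub>R (indicator {0..2*pi} t *\<^sub>R cis (real k * t)) \<partial>lborel)"
    proof (rule integral_cong_AE)
      show "AE t in lborel. (indicator {0..<2*pi} t / (2*pi)) *\<^sub>R cis t ^ k =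
          (1 / (2*pi)) *\<^sub>R (indicator {0..2*pi} t *\<^sub>R cis (real k * t))"
        using AE_lborel_singleton[of "2*pi"]
        by eventually_elim (auto simp: indicator_def Complex.DeMoivre)
    qed measurable
    also have "\<dots> = (1 / (2*pi)) *\<^sub>R (?F (2*pi) - ?F 0)"
      by (subst integral_scaleR_right, subst integral_FTC_atLeastAtMost[OF _ deriv])
         (auto intro!: continuous_intros)
    also have "\<dots> = 0"
      using cis_multiple_2pi[of "real k"] by (simp add: mult_ac)
    finally show "(\<integral>z. z ^ Suc n \<partial>circle_measure) = 0" by (simp add: k_def)
  qed
  then show ?thesis by (simp only: zpow_eq)
qed

lemma mean_cnj_zvar_power: "mean (cnj_fun zvar ^ Suc n) = 0"
  using mean_cnj[of "zvar ^ Suc n"] by (simp only: cnj_fun_power mean_zvar_power complex_cnj_zero)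

theorem Fourier_uniqueness:
  assumes W: "L1_fun W" and pos: "\<And>n. mean (W * cnj_fun zvar ^ n) = 0"
    and neg: "\<And>n. mean (W * zvar ^ n) = 0"
  shows "W = 0"
proof -
  have "mean (W * (zvar ^ m * cnj_fun zvar ^ n)) = 0" for m n
  proof (cases "n \<le> m")
    case True
    then have "zvar ^ m * cnj_fun zvar ^ n = zvar ^ (m - n) * (zvar ^ n * cnj_fun zvar ^ n)"
      by (simp flip: mult.assoc power_add)
    then show ?thesis by (simp add: zvar_power_cnj neg)
  next
    case False
    then have "zvar ^ m * cnj_fun zvar ^ n = (zvar ^ m * cnj_fun zvar ^ m) * cnj_fun zvar ^ (n - m)"
      by (simp add: mult.assoc flip: power_add)
    then show ?thesis by (simp add: zvar_power_cnj pos)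
  qed
  then have "\<forall>m n. mean (W * (zpow m * cnj_fun (zpow n))) = 0"
    by (simp add: zpow_eq)
  with W show ?thesis
  proof transfer
    fix W assume "ae_eq W W" "integrable circle_measure W"
      "\<forall>m n. (\<integral>z. W z * (z ^ m * cnj (z ^ n)) \<partial>circle_measure) = 0"
    then show "ae_eq W (\<lambda>_. 0)"
      using vanishing_moments_imp_AE_zero[of W] by (simp add: vanishing_moments_def ae_eq_def)
  qed
qed


section \<open>Hardy space functions\<close>

lemma zvar_power_H2: "zvar ^ n \<in> H2"
proof -
  have "zvar ^ n * zvar ^ Suc m = zvar ^ Suc (n + m)" for m
    by (simp add: power_add)
  then show ?thesis
    unfolding H2_iff by (simp only: mean_zvar_power zvar_power_L2 simp_thms)
qed

text \<open>The first factor lies in the closed span of the monomials with nonnegative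
  exponent, written here as a double orthogonal complement: its component orthogonal to that span has
  only zero Fourier coefficients. The conjugate of \<open>z * g\<close> is orthogonal to the span.\<close>

lemma mean_zvar_mult_H2:
  assumes k: "k \<in> H2" and g: "g \<in> H2"
  shows "mean (zvar * k * g) = 0"
proof -
  have kL2: "k \<in> L2" and gL2: "g \<in> L2"
    using k g by (auto simp: H2_iff)
  define A where "A = range (\<lambda>n. zvar ^ n)"
  define N where "N = orth (orth A)"
  have A: "A \<subseteq> L2" by (auto simp: A_def zvar_power_L2)
  have N: "closed_subspace N"
    unfolding N_def by (rule closed_subspace_orth) (auto simp: orth_def)
  obtain m where m: "m \<in> N" and r: "k - m \<in> orth N"
    using orthogonal_decomposition[OF N kL2] .
  have mL2: "m \<in> L2" using closed_subspace_L2[OF N m] .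
  have "k - m = 0"
  proof (rule Fourier_uniqueness)
    show "L1_fun (k - m)"
      using L1_fun_mult[OF L2_diff[OF kL2 mL2] L2_1] by simp
    show pos: "mean ((k - m) * cnj_fun zvar ^ n) = 0" for n
    proof -
      have "zvar ^ n \<in> N"
        using subset_orth_orth[OF A] by (auto simp: N_def A_def)
      then show ?thesis
        using r by (auto simp: orth_def l2_inner_eq)
    qed
    show "mean ((k - m) * zvar ^ n) = 0" for n
    proof (cases n)
      case 0
      then show ?thesis using pos[of 0] by simp
    next
      case (Suc j)
      have "cnj_fun zvar ^ n \<in> orth A"
        using mean_cnj_zvar_power[of "j + _"] zvar_power_L2(2)[of n]
        by (auto simp: orth_def A_def l2_inner_eq Suc power_add mult.assoc)
      then have "l2_inner m (cnj_fun zvar ^ n) = 0"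
        using m by (auto simp: N_def orth_def)
      then have "mean (m * zvar ^ n) = 0"
        by (simp add: l2_inner_eq)
      moreover have "mean (k * zvar ^ n) = 0"
        using k by (auto simp: H2_iff Suc simp del: power_Suc)
      ultimately show ?thesis
        by (simp add: left_diff_distrib mean_diff L1_fun_mult kL2 mL2 zvar_power_L2)
    qed
  qed
  then have "k \<in> N" using m by simp
  moreover have "cnj_fun (zvar * g) \<in> orth A"
  proof -
    have "mean (cnj_fun (zvar * g) * cnj_fun (zvar ^ n)) = 0" for n
    proof -
      have "cnj_fun (zvar * g) * cnj_fun (zvar ^ n) = cnj_fun (g * zvar ^ Suc n)"
        by (simp add: mult_ac)
      then show ?thesis
        using g by (simp only: mean_cnj H2_iff complex_cnj_zero)
    qed
    moreover have "cnj_fun (zvar * g) \<in> L2"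
      using Linf_mult_L2[OF zvar_power_Linf(1)[of 1] gL2] by (intro L2_cnj) simp
    ultimately show ?thesis
      by (auto simp: orth_def A_def l2_inner_eq)
  qed
  ultimately have "l2_inner k (cnj_fun (zvar * g)) = 0"
    by (auto simp: N_def orth_def)
  then show ?thesis
    by (simp add: l2_inner_eq mult_ac)
qed

text \<open>Quotients are taken pointwise with \<open>0 / 0 = 0\<close>, so \<open>h / h\<close> is the indicator of \<open>{z. h z \<noteq> 0}\<close>
  and the conclusion says that \<open>h\<close> vanishes almost nowhere. The zero set enters through its indicator
  \<open>e = 1 - h / h\<close>. Every function in the closed span \<open>N\<close> of \<open>z h, z\<^sup>2 h, \<dots>\<close> is annihilated by \<open>e\<close>,
  and so is the component \<open>g\<close> of \<open>h\<close> orthogonal to \<open>N\<close>; but \<open>|g|\<^sup>2\<close> is a nonzero constant, hence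
  \<open>e = 0\<close>.\<close>

lemma H2_quotient_self:
  assumes h: "h \<in> H2" and nz: "mean h \<noteq> 0"
  shows "h / h = 1"
proof -
  have hL2: "h \<in> L2" and h_neg: "\<And>n. mean (h * zvar ^ Suc n) = 0"
    using h by (auto simp: H2_iff)
  define e where "e = 1 - h / h"
  have eh: "e * h = 0" and ee: "e * e = e" and ce: "cnj_fun e = e"
    unfolding e_def by (transfer, auto simp: ae_eq_def divide_simps)+
  have e_Linf: "e \<in> Linf"
    unfolding e_def Linf_def mem_Collect_eq by transfer (auto intro!: exI[of _ 1] AE_I2 simp: divide_simps)
  define A where "A = range (\<lambda>n. zvar ^ Suc n * h)"
  define N where "N = orth (orth A)"
  have A: "A \<subseteq> L2"
    using hL2 by (auto simp: A_def simp del: power_Suc intro!: Linf_mult_L2 zvar_power_Linf)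
  have N: "closed_subspace N"
    unfolding N_def by (rule closed_subspace_orth) (auto simp: orth_def)
  \<comment> \<open>invariance of \<open>N\<close> under \<open>z\<close> is invariance of \<open>orth A\<close> under the adjoint \<open>cnj z\<close>\<close>
  have orth_shift: "cnj_fun zvar ^ j * f \<in> orth A" if "f \<in> orth A" for f j
    unfolding orth_def mem_Collect_eq
  proof (intro conjI ballI)
    show "cnj_fun zvar ^ j * f \<in> L2"
      using that by (auto simp: orth_def intro!: Linf_mult_L2 zvar_power_Linf)
    fix g assume "g \<in> A"
    then obtain n where "g = zvar ^ Suc n * h" by (auto simp: A_def)
    then have "zvar ^ j * g = zvar ^ Suc (j + n) * h"
      by (simp add: power_add mult_ac)
    then have "zvar ^ j * g \<in> A" unfolding A_def by blast
    then show "l2_inner (cnj_fun zvar ^ j * f) g = 0"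
      using that by (auto simp: orth_def inner_mult_left)
  qed
  have N_shift: "zvar ^ j * f \<in> N" if "f \<in> N" for f j
    using that orth_shift[of _ j]
    by (auto simp: N_def orth_def[of "orth A"] inner_mult_left Linf_mult_L2 zvar_power_Linf)
  \<comment> \<open>\<open>e * f\<close> is orthogonal to the generators, hence to \<open>f\<close>; and \<open>e\<close> acts as an orthogonal projection\<close>
  have N_e: "e * f = 0" if "f \<in> N" for f
  proof -
    have fL2: "f \<in> L2" using closed_subspace_L2[OF N that] .
    have "e * f \<in> orth A"
    proof -
      have ech: "e * cnj_fun h = 0"
        using arg_cong[OF eh, of cnj_fun] by (simp add: ce)
      have "l2_inner (e * f) (zvar ^ Suc n * h) = 0" for n
      proof -
        have "e * f * cnj_fun (zvar ^ Suc n * h) = (e * cnj_fun h) * (f * cnj_fun (zvar ^ Suc n))"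
          by (simp add: mult_ac)
        then show ?thesis unfolding l2_inner_eq ech by simp
      qed
      then show ?thesis
        using Linf_mult_L2[OF e_Linf fL2] by (auto simp: orth_def A_def)
    qed
    then have "l2_inner f (e * f) = 0"
      using that by (auto simp: N_def orth_def)
    then have "l2_inner (e * f) (e * f) = 0"
      by (simp add: inner_mult_left ce ee flip: mult.assoc)
    then show ?thesis
      using inner_self_eq_0 Linf_mult_L2[OF e_Linf fL2] by blast
  qed
  have N_mean: "mean f = 0" if "f \<in> N" for f
  proof -
    \<comment> \<open>\<open>z\<^sup>n h\<close> has mean zero for \<open>n \<ge> 1\<close>\<close>
    have "1 \<in> orth A"
    proof -
      have "l2_inner 1 (zvar ^ Suc n * h) = cnj (mean (h * zvar ^ Suc n))" for n
        by (simp only: l2_inner_eq mean_cnj mult_1 mult.commute)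
      then show ?thesis
        by (auto simp: orth_def A_def h_neg simp del: power_Suc)
    qed
    then have "l2_inner f 1 = 0"
      using that by (auto simp: N_def orth_def)
    then show ?thesis by (simp add: l2_inner_eq)
  qed
  obtain m where m: "m \<in> N" and g: "h - m \<in> orth N"
    using orthogonal_decomposition[OF N hL2] .
  define g where "g = h - m"
  have gL2: "g \<in> L2" and g_orth: "\<And>f. f \<in> N \<Longrightarrow> l2_inner g f = 0"
    using g by (auto simp: g_def orth_def)
  have eg: "e * g = 0"
    by (simp add: g_def right_diff_distrib eh N_e[OF m])
  have g_nz: "g \<noteq> 0"
    using N_mean[OF m] nz by (auto simp: g_def)
  define c where "c = mean (g * cnj_fun g)"
  have c_nz: "c \<noteq> 0"
    using inner_self_eq_0[OF gL2] g_nz by (auto simp: c_def l2_inner_eq)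
  \<comment> \<open>\<open>z\<^sup>n g\<close> with \<open>n \<ge> 1\<close> lies in \<open>N\<close>, to which \<open>g\<close> is orthogonal\<close>
  have g_pos: "mean (g * cnj_fun g * cnj_fun zvar ^ Suc n) = 0" for n
  proof -
    have "zvar ^ Suc n * h \<in> N"
      using subset_orth_orth[OF A] unfolding N_def A_def by blast
    then have "zvar ^ Suc n * g \<in> N"
      using closed_subspace_diff[OF N _ N_shift[OF m, of "Suc n"]]
      by (simp add: g_def right_diff_distrib)
    from g_orth[OF this] show ?thesis
      by (simp add: l2_inner_eq mult_ac)
  qed
  have g_neg: "mean (g * cnj_fun g * zvar ^ Suc n) = 0" for n
  proof -
    have "mean (cnj_fun (g * cnj_fun g * cnj_fun zvar ^ Suc n)) = 0"
      by (simp only: mean_cnj g_pos complex_cnj_zero)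
    then show ?thesis by (simp add: mult_ac)
  qed
  have gg: "L1_fun (g * cnj_fun g)"
    using gL2 by (simp add: L2_iff_L1)
  have "g * cnj_fun g - const c = 0"
  proof (rule Fourier_uniqueness)
    show "L1_fun (g * cnj_fun g - const c)"
      by (intro L1_fun_diff gg) simp
    have L1: "L1_fun (g * cnj_fun g * zvar ^ n)" "L1_fun (g * cnj_fun g * cnj_fun zvar ^ n)"
      "L1_fun (const c * zvar ^ n)" "L1_fun (const c * cnj_fun zvar ^ n)" for n
      using L1_fun_Linf_mult[OF zvar_power_Linf(1) gg] L1_fun_Linf_mult[OF zvar_power_Linf(2) gg]
        L1_fun_mult[OF L2_const zvar_power_L2(1)] L1_fun_mult[OF L2_const zvar_power_L2(2)]
      by (simp_all add: mult.commute)
    show "mean ((g * cnj_fun g - const c) * zvar ^ n) = 0" for n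
      by (cases n) (simp_all add: left_diff_distrib mean_diff L1 g_neg mean_const_mult mean_zvar_power
          c_def[symmetric] gg del: power_Suc)
    show "mean ((g * cnj_fun g - const c) * cnj_fun zvar ^ n) = 0" for n
      by (cases n) (simp_all add: left_diff_distrib mean_diff L1 g_pos mean_const_mult mean_cnj_zvar_power
          c_def[symmetric] gg del: power_Suc)
  qed
  then have "const c = g * cnj_fun g" by simp
  then have "const c * e = (e * g) * cnj_fun g" by (simp add: mult_ac)
  then have "const c * e = 0" by (simp only: eg mult_zero_left)
  then have "e = 0" using c_nz by simp
  then show ?thesis by (simp add: e_def)
qed


section \<open>Complex symmetry\<close>

lemma proj_eqI:
  assumes N: "closed_subspace N" and f: "f \<in> L2" and g: "g \<in> N"
    and orth: "\<And>k. k \<in> N \<Longrightarrow> l2_inner (f - g) k = 0"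
  shows "proj N f = g"
  unfolding proj_def
proof (rule the_equality)
  show "g \<in> N \<and> (\<forall>k\<in>N. l2_inner (f - g) k = 0)" using g orth by blast
  fix g' assume g': "g' \<in> N \<and> (\<forall>k\<in>N. l2_inner (f - g') k = 0)"
  have L2: "g \<in> L2" "g' \<in> L2"
    using g g' closed_subspace_L2[OF N] by auto
  have "g' - g \<in> orth N"
    unfolding orth_def mem_Collect_eq
  proof (intro conjI ballI L2_diff L2)
    fix k assume k: "k \<in> N"
    have "l2_inner ((f - g) - (f - g')) k = 0"
      using orth[OF k] g' k f L2 closed_subspace_L2[OF N k]
      by (subst inner_diff_left) (auto intro: L2_diff)
    then show "l2_inner (g' - g) k = 0" by simp
  qed
  then have "g' - g = 0"
    using orth_Int[OF N] closed_subspace_diff[OF N] g g' by blast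
  then show "g' = g" by simp
qed

lemma proj_props:
  assumes N: "closed_subspace N" and f: "f \<in> L2"
  shows "proj N f \<in> N" and "k \<in> N \<Longrightarrow> l2_inner (f - proj N f) k = 0"
proof -
  obtain m where "m \<in> N" "f - m \<in> orth N"
    using orthogonal_decomposition[OF N f] .
  moreover from this have "proj N f = m"
    by (intro proj_eqI[OF N f]) (auto simp: orth_def)
  ultimately show "proj N f \<in> N" and "k \<in> N \<Longrightarrow> l2_inner (f - proj N f) k = 0"
    by (auto simp: orth_def)
qed

lemma adjoint_on_eqI:
  assumes N: "closed_subspace N" and g': "g' \<in> N"
    and adj: "\<And>f. f \<in> N \<Longrightarrow> l2_inner (B f) g = l2_inner f g'"
  shows "adjoint_on N B g = g'"
  unfolding adjoint_on_def
proof (rule the_equality)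
  show "g' \<in> N \<and> (\<forall>f\<in>N. l2_inner (B f) g = l2_inner f g')" using g' adj by blast
  fix k assume k: "k \<in> N \<and> (\<forall>f\<in>N. l2_inner (B f) g = l2_inner f k)"
  have d: "k - g' \<in> N" using closed_subspace_diff[OF N] k g' by blast
  then have "l2_inner (k - g') (k - g') = 0"
    using k adj g' by (subst inner_diff_right) (auto intro: closed_subspace_L2[OF N])
  then have "k - g' = 0"
    using inner_self_eq_0 closed_subspace_L2[OF N d] by blast
  then show "k = g'" by simp
qed

text \<open>The map \<open>J f = q * cnj f\<close> satisfies \<open>\<langle>J f, g\<rangle> = \<langle>J g, f\<rangle>\<close>. Hence for \<open>f\<close> and \<open>k\<close> in \<open>N\<close> the difference between
  \<open>cnj \<phi> * f = J (\<phi> * J f)\<close> and \<open>J (D (J f))\<close> has the inner product \<open>\<langle>J k, \<phi> * J f - D (J f)\<rangle>\<close> with \<open>k\<close>,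
  and this is zero because \<open>J k \<in> N\<close>. Both \<open>J (D (J f))\<close> and the adjoint of \<open>D\<close> at \<open>f\<close> are therefore
  the projection of \<open>cnj \<phi> * f\<close>.\<close>

lemma complex_symmetric_compression:
  assumes N: "closed_subspace N" and q: "q * cnj_fun q = 1" and phi: "\<phi> \<in> Linf"
    and inv: "\<And>f. f \<in> N \<Longrightarrow> q * cnj_fun f \<in> N"
  shows "complex_symmetric_on N (\<lambda>f. q * cnj_fun f) (\<lambda>f. proj N (\<phi> * f))"
proof -
  define J where "J f = q * cnj_fun f" for f
  have J_inv: "J f \<in> N" if "f \<in> N" for f
    using inv[OF that] by (simp add: J_def)
  have JJ: "J (J f) = f" for f
    by (simp add: J_def q flip: mult.assoc)
  have J_L2: "J f \<in> L2" if "f \<in> L2" for f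
    unfolding J_def by (intro Linf_mult_L2 unimodular_in_Linf q L2_cnj that)
  have J_diff: "J (f - g) = J f - J g" for f g
    by (simp add: J_def right_diff_distrib)
  have J_sym: "l2_inner (J f) g = l2_inner (J g) f" for f g
    by (simp add: l2_inner_eq J_def mult_ac)
  have J_norm: "l2_norm (J f) = l2_norm f" for f
  proof -
    have "l2_inner (J f) (J f) = l2_inner f f"
      by (subst J_sym) (simp only: JJ)
    then have "(l2_norm (J f))\<^sup>2 = (l2_norm f)\<^sup>2"
      by (simp add: l2_norm_inner flip: of_real_power)
    then show ?thesis by (simp add: power2_eq_iff_nonneg)
  qed
  have L2: "f \<in> L2" if "f \<in> N" for f using closed_subspace_L2[OF N that] .
  define D where "D f = proj N (\<phi> * f)" for f
  have phi_L2: "\<phi> * f \<in> L2" "cnj_fun \<phi> * f \<in> L2" if "f \<in> L2" for f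
    using that phi by (auto intro: Linf_mult_L2 Linf_cnj)
  have D_N: "D f \<in> N" if "f \<in> N" for f
    unfolding D_def by (rule proj_props(1)[OF N phi_L2(1)[OF L2[OF that]]])
  have D_orth: "l2_inner (\<phi> * f - D f) k = 0" if "f \<in> N" "k \<in> N" for f k
    unfolding D_def by (rule proj_props(2)[OF N phi_L2(1)[OF L2] that(2)]) fact
  have JDJ: "J (D (J f)) = proj N (cnj_fun \<phi> * f)" if f: "f \<in> N" for f
  proof (rule sym, rule proj_eqI[OF N])
    show "cnj_fun \<phi> * f \<in> L2" using phi_L2 L2[OF f] by blast
    show "J (D (J f)) \<in> N" by (intro J_inv D_N f)
    fix k assume k: "k \<in> N"
    have "cnj_fun \<phi> * f = J (\<phi> * J f)"
    proof -
      have "J (\<phi> * J f) = (q * cnj_fun q) * (cnj_fun \<phi> * f)"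
        by (simp add: J_def mult_ac)
      then show ?thesis by (simp add: q)
    qed
    then have "cnj_fun \<phi> * f - J (D (J f)) = J (\<phi> * J f - D (J f))"
      by (simp add: J_diff)
    also have "l2_inner \<dots> k = l2_inner (J k) (\<phi> * J f - D (J f))"
      by (rule J_sym)
    also have "\<dots> = cnj (l2_inner (\<phi> * J f - D (J f)) (J k))"
      by (rule inner_commute)
    also have "\<dots> = 0"
      using D_orth[OF J_inv[OF f] J_inv[OF k]] by simp
    finally show "l2_inner (cnj_fun \<phi> * f - J (D (J f))) k = 0" .
  qed
  have adj: "adjoint_on N D f = proj N (cnj_fun \<phi> * f)" if f: "f \<in> N" for f
  proof (rule adjoint_on_eqI[OF N])
    let ?g = "proj N (cnj_fun \<phi> * f)"
    note P = proj_props[OF N phi_L2(2)[OF L2[OF f]]]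
    show "?g \<in> N" by (rule P)
    fix k assume k: "k \<in> N"
    have "l2_inner (D k) f = l2_inner (\<phi> * k) f"
      using D_orth[OF k f] by (subst (asm) inner_diff_left) (auto intro: L2 f k D_N phi_L2)
    also have "\<dots> = l2_inner k (cnj_fun \<phi> * f)"
      by (rule inner_mult_left)
    also have "\<dots> = l2_inner k ?g"
    proof -
      have "l2_inner k (cnj_fun \<phi> * f - ?g) = 0"
        using P(2)[OF k] inner_commute by (metis complex_cnj_zero)
      then show ?thesis
        by (subst (asm) inner_diff_right) (auto intro: L2 f k P phi_L2)
    qed
    finally show "l2_inner (D k) f = l2_inner k ?g" .
  qed
  have "complex_symmetric_on N J D"
    unfolding complex_symmetric_on_def conjugation_on_def
    using J_inv JJ J_norm JDJ adj
    by (auto simp: J_def distrib_left mult_ac)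
  then show ?thesis by (simp add: J_def[abs_def] D_def[abs_def])
qed

text \<open>Orthogonality of \<open>k\<close> to \<open>u * z\<^sup>n\<close> says that \<open>u * cnj z * cnj k\<close> has no negative Fourier
  coefficients; its orthogonality to \<open>u * f\<close> says that \<open>z * k * f\<close> has mean zero.\<close>

lemma model_space_conj:
  assumes u: "inner_function u" and k: "k \<in> model_space u"
  shows "u * cnj_fun zvar * cnj_fun k \<in> model_space u"
proof -
  have uu: "u * cnj_fun u = 1"
    using u by (simp add: inner_function_def)
  have kH2: "k \<in> H2" and k_orth: "\<And>f. f \<in> H2 \<Longrightarrow> l2_inner k (u * f) = 0"
    using k by (auto simp: model_space_def orth_def)
  have L2: "u * cnj_fun zvar * cnj_fun k \<in> L2"
    using kH2 zvar_power_Linf(2)[of 1]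
    by (intro Linf_mult_L2 Linf_mult unimodular_in_Linf[OF uu] L2_cnj) (auto simp: H2_iff)
  have "mean (u * cnj_fun zvar * cnj_fun k * zvar ^ Suc n) = 0" for n
  proof -
    have "u * cnj_fun zvar * cnj_fun k * zvar ^ Suc n =
        (zvar * cnj_fun zvar) * cnj_fun (k * cnj_fun (u * zvar ^ n))"
      by (simp add: mult_ac)
    then show ?thesis
      using k_orth[OF zvar_power_H2[of n]] by (simp only: zvar_cnj l2_inner_eq mean_cnj mult_1 complex_cnj_zero)
  qed
  moreover have "l2_inner (u * cnj_fun zvar * cnj_fun k) (u * f) = 0" if f: "f \<in> H2" for f
  proof -
    have "u * cnj_fun zvar * cnj_fun k * cnj_fun (u * f) = (u * cnj_fun u) * cnj_fun (zvar * k * f)"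
      by (simp add: mult_ac)
    then show ?thesis
      using mean_zvar_mult_H2[OF kH2 f] by (simp only: uu l2_inner_eq mean_cnj mult_1 complex_cnj_zero)
  qed
  ultimately show ?thesis
    using L2 by (auto simp: model_space_def orth_def H2_iff)
qed

theorem theorem3p11:
  fixes M :: "circle_fun set" and u h \<phi> :: circle_fun
  assumes "nearly_invariant M" and "M \<noteq> {0}" and "M \<noteq> H2"
    and "inner_function u" and "\<forall>c. u \<noteq> const c" and "disk_value u 0 = 0"
    and "extremal_function M h"
    and "M = (\<lambda>f. h * f) ` model_space u"
    and "\<forall>f\<in>model_space u. l2_norm (h * f) = l2_norm f"
    and "\<phi> \<in> Linf"
  shows "complex_symmetric_on (orth M) (J_conj u h) (dual_toeplitz M \<phi>)"
proof -
  have M: "M \<subseteq> L2" "M \<subseteq> H2"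
    using assms(1) by (auto simp: nearly_invariant_def closed_subspace_def)
  have "h \<in> H2" "mean h \<noteq> 0"
    using assms(7) M by (auto simp: extremal_function_def disk_value_0)
  then have "h / h = 1" by (rule H2_quotient_self)
  then have hh: "(h / cnj_fun h) * cnj_fun (h / cnj_fun h) = 1"
    by transfer (auto simp: ae_eq_def divide_simps elim!: eventually_mono split: if_splits)
  have hcancel: "(h / cnj_fun h) * cnj_fun h = h"
    by transfer (auto simp: ae_eq_def)
  define q where "q = u * cnj_fun zvar * (h / cnj_fun h)"
  have J: "J_conj u h = (\<lambda>f. q * cnj_fun f)"
    by (simp add: fun_eq_iff J_conj_def q_def)
  have q: "q * cnj_fun q = 1"
  proof -
    have "q * cnj_fun q = (u * cnj_fun u) * (zvar * cnj_fun zvar) * ((h / cnj_fun h) * cnj_fun (h / cnj_fun h))"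
      unfolding q_def by (simp add: mult_ac)
    then show ?thesis
      using assms(4) by (simp only: zvar_cnj hh inner_function_def mult_1)
  qed
  have J_M: "q * cnj_fun f \<in> M" if f: "f \<in> M" for f
  proof -
    from f obtain k where k: "k \<in> model_space u" "f = h * k"
      unfolding assms(8) by blast
    have "q * cnj_fun f = ((h / cnj_fun h) * cnj_fun h) * (u * cnj_fun zvar * cnj_fun k)"
      by (simp add: q_def k(2) mult_ac)
    then show ?thesis
      using model_space_conj[OF assms(4) k(1)] assms(8) by (simp only: hcancel) blast
  qed
  have "q * cnj_fun f \<in> orth M" if f: "f \<in> orth M" for f
    unfolding orth_def mem_Collect_eq
  proof (intro conjI ballI)
    show "q * cnj_fun f \<in> L2"
      using f by (auto simp: orth_def intro!: Linf_mult_L2 unimodular_in_Linf q L2_cnj)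
    fix g assume "g \<in> M"
    then have "l2_inner f (q * cnj_fun g) = 0"
      using f J_M by (auto simp: orth_def)
    then have "l2_inner (q * cnj_fun g) f = 0"
      by (metis complex_cnj_zero inner_commute)
    then show "l2_inner (q * cnj_fun f) g = 0"
      by (simp add: l2_inner_eq mult_ac)
  qed
  then show ?thesis
    unfolding J using complex_symmetric_compression[OF closed_subspace_orth[OF M(1)] q assms(10)]
    by (simp add: dual_toeplitz_def[abs_def])
qed


end
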